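(* Let $(D,\theta)$ be a finite-dimensional division algebra with involution of the first kind over a field $F$. Let $K/F$ be a separable quadratic extension such that $D_K=D\otimes_FK$ is a division ring. Let $\lambda=\pm1$ and suppose that either $D\neq F$ or $\lambda\neq-1$. For a regular even $\lambda$-hermitian space $(V,h)$ over $(D,\theta)_K$ the following are equivalent: (i) $h$ has a descent to $(D,\theta)$; (ii) there exists an $F$-basis $\mathcal{B}$ of $\mathrm{Symd}_\lambda(D,\theta)$ for which $q_{h,\mathcal{B}_K}$ has a descent to $F$ (i.e. to $F^m$, $m=|\mathcal{B}|$).
   Context: The field $F$ has arbitrary characteristic. An involution of the first kind is an antiautomorphism of order $2$ restricting to the identity on the centre. $(D,\theta)_K=(D\otimes_FK,\theta\otimes\mathrm{id})$. $\mathrm{Symd}_\lambda(A,\sigma)=\{x+\lambda\sigma(x)\mid x\in A\}$. A $\lambda$-hermitian space $(V,h)$ over a division algebra with involution $(A,\sigma)$ is a finite-dimensional right $A$-space $V$ with a bi-additive $h:V\times V\to A$ satisfying $h(u\alpha,v\beta)=\sigma(\alpha)h(u,v)\beta$ and $h(v,u)=\lambda\sigma(h(u,v))$; it is regular if no nonzero $v$ satisfies $h(v,w)=0$ for all $w$, and even if $h(v,v)\in\mathrm{Symd}_\lambda(A,\sigma)$ for all $v$. $h$ has a descent to $(D,\theta)$ if there is a $\lambda$-hermitian space $(V'',h'')$ over $(D,\theta)$ with $(V,h)\simeq(V''\otimes_FK,h''_K)$, where $h''_K(u\otimes\alpha,v\otimes\beta)=h''(u,v)\otimes\alpha\beta$.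 If $\mathcal{B}=\{u_1,\dots,u_m\}$ is an $F$-basis of $\mathrm{Symd}_\lambda(D,\theta)$, then $\mathcal{B}_K=\{u_i\otimes1\}$ is a $K$-basis of $\mathrm{Symd}_\lambda((D,\theta)_K)$; with dual basis $\pi_1,\dots,\pi_m$ of $\mathcal{B}_K$, $q_{h,\mathcal{B}_K}:V\to K^m$ is the system of quadratic forms over $K$ (on $V$ viewed as a $K$-space) with components $v\mapsto\pi_i(h(v,v))$. A quadratic map $q:V\to K^m$ has a descent to $F^m$ if there is an $F$-space $V'$ and a quadratic map $\rho:V'\to F^m$ and a $K$-linear isomorphism $f:V\to V'\otimes_FK$ with $\rho_K(f(v))=q(v)$, where $\rho_K(v\otimes\alpha)=\alpha^2\rho(v)$ extended quadratically. *)

theory Defs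
  imports Main
begin

text \<open>Everything lives inside one ambient division ring 'e, which plays the role of
  D_K = D \<otimes>_F K.  F, K and D are subsets of it; the tensor product D \<otimes>_F K is
  encoded internally: the natural map D \<otimes>_F K \<rightarrow> 'e, d \<otimes> k \<mapsto> d k, is bijective.
  Vector spaces are right spaces given by an action act :: 'v \<Rightarrow> 'e \<Rightarrow> 'v.\<close>

definition centre :: "'e::ring_1 set" where
  "centre = {z. \<forall>x. z * x = x * z}"

definition is_subfield :: "'e::division_ring set \<Rightarrow> bool" where
  "is_subfield S \<longleftrightarrow> 0 \<in> S \<and> 1 \<in> S \<and>
     (\<forall>x\<in>S. \<forall>y\<in>S. x + y \<in> S \<and> x * y \<in> S \<and> x * y = y * x) \<and>
     (\<forall>x\<in>S. - x \<in> S \<and> inverse x \<in> S)"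

definition is_division_subring :: "'e::division_ring set \<Rightarrow> bool" where
  "is_division_subring S \<longleftrightarrow> 0 \<in> S \<and> 1 \<in> S \<and>
     (\<forall>x\<in>S. \<forall>y\<in>S. x + y \<in> S \<and> x * y \<in> S) \<and>
     (\<forall>x\<in>S. - x \<in> S \<and> inverse x \<in> S)"

definition lin_span :: "('v::ab_group_add \<Rightarrow> 'e \<Rightarrow> 'v) \<Rightarrow> 'e set \<Rightarrow> 'v set \<Rightarrow> 'v set" where
  "lin_span act S X = {(\<Sum>i<n. act (w i) (c i)) | (n::nat) w c. \<forall>i<n. w i \<in> X \<and> c i \<in> S}"

definition lin_indep :: "('v::ab_group_add \<Rightarrow> 'e::zero \<Rightarrow> 'v) \<Rightarrow> 'e set \<Rightarrow> 'v set \<Rightarrow> bool" where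
  "lin_indep act S X \<longleftrightarrow> (\<forall>(n::nat) w c. (\<forall>i<n. w i \<in> X \<and> c i \<in> S) \<and> inj_on w {..<n} \<and>
       (\<Sum>i<n. act (w i) (c i)) = 0 \<longrightarrow> (\<forall>i<n. c i = 0))"

definition subspace_over :: "('v::ab_group_add \<Rightarrow> 'e \<Rightarrow> 'v) \<Rightarrow> 'e set \<Rightarrow> 'v set \<Rightarrow> bool" where
  "subspace_over act S W \<longleftrightarrow> 0 \<in> W \<and> (\<forall>x\<in>W. \<forall>y\<in>W. x + y \<in> W) \<and> (\<forall>x\<in>W. \<forall>a\<in>S. act x a \<in> W)"

text \<open>For an F-subspace W of a K-space U (F \<subseteq> K), the natural K-linear map
  W \<otimes>_F K \<rightarrow> U, w \<otimes> k \<mapsto> w k, is an isomorphism: it is onto (W spans U over K) and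
  one-to-one (F-linearly independent families in W stay K-linearly independent).\<close>

definition scalar_ext_iso ::
  "('v::ab_group_add \<Rightarrow> 'e::zero \<Rightarrow> 'v) \<Rightarrow> 'e set \<Rightarrow> 'e set \<Rightarrow> 'v set \<Rightarrow> 'v set \<Rightarrow> bool" where
  "scalar_ext_iso act F K W U \<longleftrightarrow>
     lin_span act K W = U \<and> (\<forall>X\<subseteq>W. lin_indep act F X \<longrightarrow> lin_indep act K X)"

definition quadratic_ext :: "'e::division_ring set \<Rightarrow> 'e set \<Rightarrow> bool" where
  "quadratic_ext F K \<longleftrightarrow> (\<exists>\<alpha>\<in>K. \<alpha> \<notin> F \<and> lin_span (*) F {1, \<alpha>} = K)"

text \<open>Every element x of K \<setminus> F has minimal polynomial X^2 - t X - n over F; it is separable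
  iff its derivative does not vanish at x, i.e. 2x \<noteq> t.\<close>
definition separable_ext :: "'e::division_ring set \<Rightarrow> 'e set \<Rightarrow> bool" where
  "separable_ext F K \<longleftrightarrow> (\<forall>x\<in>K - F. \<forall>t\<in>F. \<forall>n\<in>F. x * x = t * x + n \<longrightarrow> t \<noteq> x + x)"

text \<open>Involution of the first kind on D: antiautomorphism with \<theta>\<circ>\<theta> = id (so \<theta> = id is
  allowed, e.g. for D = F) which is the identity on the centre of D.\<close>

definition involution_first_kind :: "'e::division_ring set \<Rightarrow> ('e \<Rightarrow> 'e) \<Rightarrow> bool" where
  "involution_first_kind D \<theta> \<longleftrightarrow>
     (\<forall>x\<in>D. \<theta> x \<in> D) \<and>
     (\<forall>x\<in>D. \<forall>y\<in>D. \<theta> (x + y) = \<theta> x + \<theta> y \<and> \<theta> (x * y) = \<theta> y * \<theta> x) \<and>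
     (\<forall>x\<in>D. \<theta> (\<theta> x) = x) \<and>
     (\<forall>z\<in>D. (\<forall>x\<in>D. z * x = x * z) \<longrightarrow> \<theta> z = z)"

text \<open>\<sigma> is \<theta> \<otimes> id on D_K = D \<otimes>_F K (uniquely determined by these conditions).\<close>

definition is_theta_K :: "'e::division_ring set \<Rightarrow> 'e set \<Rightarrow> ('e \<Rightarrow> 'e) \<Rightarrow> ('e \<Rightarrow> 'e) \<Rightarrow> bool" where
  "is_theta_K D K \<theta> \<sigma> \<longleftrightarrow> (\<forall>x y. \<sigma> (x + y) = \<sigma> x + \<sigma> y) \<and> (\<forall>d\<in>D. \<forall>k\<in>K. \<sigma> (d * k) = \<theta> d * k)"

definition Symd :: "'e::ring_1 \<Rightarrow> 'e set \<Rightarrow> ('e \<Rightarrow> 'e) \<Rightarrow> 'e set" where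
  "Symd lam A s = {x + lam * s x | x. x \<in> A}"

definition herm_space ::
  "'e::division_ring set \<Rightarrow> ('e \<Rightarrow> 'e) \<Rightarrow> 'e \<Rightarrow> 'v::ab_group_add set \<Rightarrow> ('v \<Rightarrow> 'e \<Rightarrow> 'v) \<Rightarrow> ('v \<Rightarrow> 'v \<Rightarrow> 'e) \<Rightarrow> bool" where
  "herm_space A s lam Vc act h \<longleftrightarrow>
     subspace_over act A Vc \<and>
     (\<forall>u\<in>Vc. \<forall>v\<in>Vc. \<forall>a\<in>A. act (u + v) a = act u a + act v a) \<and>
     (\<forall>u\<in>Vc. \<forall>a\<in>A. \<forall>b\<in>A. act u (a + b) = act u a + act u b \<and> act u (a * b) = act (act u a) b) \<and>
     (\<forall>u\<in>Vc. act u 1 = u) \<and>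
     (\<exists>X. finite X \<and> X \<subseteq> Vc \<and> lin_span act A X = Vc) \<and>
     (\<forall>u\<in>Vc. \<forall>v\<in>Vc. h u v \<in> A) \<and>
     (\<forall>u\<in>Vc. \<forall>u'\<in>Vc. \<forall>v\<in>Vc. h (u + u') v = h u v + h u' v \<and> h v (u + u') = h v u + h v u') \<and>
     (\<forall>u\<in>Vc. \<forall>v\<in>Vc. \<forall>a\<in>A. \<forall>b\<in>A. h (act u a) (act v b) = s a * h u v * b) \<and>
     (\<forall>u\<in>Vc. \<forall>v\<in>Vc. h v u = lam * s (h u v))"

definition herm_regular :: "'v::zero set \<Rightarrow> ('v \<Rightarrow> 'v \<Rightarrow> 'e::zero) \<Rightarrow> bool" where
  "herm_regular Vc h \<longleftrightarrow> (\<forall>v\<in>Vc. (\<forall>w\<in>Vc. h v w = 0) \<longrightarrow> v = 0)"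

definition herm_even :: "'e::ring_1 set \<Rightarrow> ('e \<Rightarrow> 'e) \<Rightarrow> 'e \<Rightarrow> 'v set \<Rightarrow> ('v \<Rightarrow> 'v \<Rightarrow> 'e) \<Rightarrow> bool" where
  "herm_even A s lam Vc h \<longleftrightarrow> (\<forall>v\<in>Vc. h v v \<in> Symd lam A s)"

text \<open>h has a descent to (D,\<theta>): (V,h) \<simeq> (V''\<otimes>_F K, h''_K).  Internally: there is an
  F-structure W of V that is a D-subspace, on which h restricts to a lambda-hermitian form
  over (D,\<theta>), with W \<otimes>_F K \<rightarrow> V bijective.\<close>

definition herm_descent ::
  "'e::division_ring set \<Rightarrow> 'e set \<Rightarrow> 'e set \<Rightarrow> ('e \<Rightarrow> 'e) \<Rightarrow> 'e \<Rightarrow> 'v::ab_group_add set \<Rightarrow> ('v \<Rightarrow> 'e \<Rightarrow> 'v) \<Rightarrow> ('v \<Rightarrow> 'v \<Rightarrow> 'e) \<Rightarrow> bool" where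
  "herm_descent F K D \<theta> lam Vc act h \<longleftrightarrow>
     (\<exists>W. W \<subseteq> Vc \<and> herm_space D \<theta> lam W act h \<and> scalar_ext_iso act F K W Vc)"

definition is_basis_list :: "'e::division_ring set \<Rightarrow> 'e set \<Rightarrow> (nat \<Rightarrow> 'e) \<Rightarrow> nat \<Rightarrow> bool" where
  "is_basis_list F S B m \<longleftrightarrow> inj_on B {..<m} \<and> B ` {..<m} \<subseteq> S \<and>
     lin_indep (*) F (B ` {..<m}) \<and> lin_span (*) F (B ` {..<m}) = S"

text \<open>q_{h,B_K}(v) = (\<pi>_1(h(v,v)),...,\<pi>_m(h(v,v))), with \<pi>_i the dual basis of
  B_K = {u_i \<otimes> 1}; here u_i \<otimes> 1 is B i \<in> D \<subseteq> D_K.  Vectors of K^m are functions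
  nat \<Rightarrow> 'e, zero outside {..<m}.\<close>

definition q_form :: "'e::division_ring set \<Rightarrow> ('v \<Rightarrow> 'v \<Rightarrow> 'e) \<Rightarrow> (nat \<Rightarrow> 'e) \<Rightarrow> nat \<Rightarrow> 'v \<Rightarrow> nat \<Rightarrow> 'e" where
  "q_form K h B m v = (THE c. (\<forall>j<m. c j \<in> K) \<and> (\<forall>j. m \<le> j \<longrightarrow> c j = 0) \<and>
                               h v v = (\<Sum>j<m. c j * B j))"

definition quad_map :: "('v::ab_group_add \<Rightarrow> 'e::ring_1 \<Rightarrow> 'v) \<Rightarrow> 'e set \<Rightarrow> 'v set \<Rightarrow> nat \<Rightarrow> ('v \<Rightarrow> nat \<Rightarrow> 'e) \<Rightarrow> bool" where
  "quad_map act S Vc m q \<longleftrightarrow>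
     (\<forall>v\<in>Vc. \<forall>i. m \<le> i \<longrightarrow> q v i = 0) \<and>
     (\<forall>v\<in>Vc. \<forall>i<m. q v i \<in> S) \<and>
     (\<forall>v\<in>Vc. \<forall>a\<in>S. \<forall>i<m. q (act v a) i = a * a * q v i) \<and>
     (let b = (\<lambda>u v i. q (u + v) i - q u i - q v i) in
        (\<forall>u\<in>Vc. \<forall>u'\<in>Vc. \<forall>v\<in>Vc. \<forall>i<m. b (u + u') v i = b u v i + b u' v i) \<and>
        (\<forall>u\<in>Vc. \<forall>v\<in>Vc. \<forall>a\<in>S. \<forall>i<m. b (act u a) v i = a * b u v i))"

text \<open>q : V \<rightarrow> K^m has a descent to F^m: internally, an F-structure W of the K-space V
  (W \<otimes>_F K \<rightarrow> V bijective) on which q restricts to a quadratic map \<rho> : W \<rightarrow> F^m.\<close>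

definition quad_descent ::
  "('v::ab_group_add \<Rightarrow> 'e::division_ring \<Rightarrow> 'v) \<Rightarrow> 'e set \<Rightarrow> 'e set \<Rightarrow> 'v set \<Rightarrow> nat \<Rightarrow> ('v \<Rightarrow> nat \<Rightarrow> 'e) \<Rightarrow> bool" where
  "quad_descent act F K Vc m q \<longleftrightarrow>
     (\<exists>W. W \<subseteq> Vc \<and> subspace_over act F W \<and> scalar_ext_iso act F K W Vc \<and> quad_map act F W m q)"

end

theory Submission
  imports Defs
begin

text \<open>Write \<open>K = F + F \<alpha>\<close>, so that every element of \<open>D\<^sub>K\<close> is uniquely \<open>d + d' \<alpha>\<close> with
  \<open>d\<close>, \<open>d'\<close> in \<open>D\<close>, and let \<open>im\<close> be the map \<open>d + d' \<alpha> \<mapsto> d'\<close>.  To descend \<open>h\<close>, take a maximal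
  \<open>D\<close>-subspace \<open>P\<close> on which \<open>h\<close> is \<open>D\<close>-valued and regular and for which \<open>V\<close> splits as
  \<open>P K \<bottom> P\<^sup>\<bottom>\<close>.  By maximality a vector \<open>u\<close> of \<open>P\<^sup>\<bottom>\<close> with \<open>h u u\<close> in \<open>D\<close> vanishes: otherwise
  \<open>P\<close> could be enlarged by \<open>u D\<close> or by a hyperbolic plane through \<open>u\<close>.  It remains to prove
  \<open>P\<^sup>\<bottom> = 0\<close>.  If \<open>Symd\<close> is zero, every vector is isotropic.  Otherwise compose the polar form of
  one component of the quadratic system with \<open>im\<close> to get a nondegenerate symmetric bilinear form
  over \<open>F\<close>.  The \<open>F\<close>-structure \<open>W\<close> given by the descent of the quadratic system equals its own
  orthogonal space for this form, while \<open>P\<close> is totally isotropic for it, and the maximality of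
  \<open>P\<close> says \<open>W \<inter> P\<^sup>o \<subseteq> P\<close> for the orthogonal space \<open>P\<^sup>o\<close>.  Passing to orthogonal spaces,
  \<open>P\<^sup>o \<subseteq> W + P\<close>, hence \<open>P\<^sup>o = P\<close>, which forces \<open>P\<^sup>\<bottom> = 0\<close>.\<close>

section \<open>Linear algebra over a division subring\<close>

text \<open>One setting serves right spaces over \<open>F\<close>, \<open>K\<close>,
  \<open>D\<close> and the whole ambient ring, both for the hermitian space and for the ring acting
  on itself by multiplication.\<close>

locale scalars =
  fixes S :: "'e::division_ring set" and act :: "'v::ab_group_add \<Rightarrow> 'e \<Rightarrow> 'v"
  assumes S: "is_division_subring S"
    and act_add: "a \<in> S \<Longrightarrow> act (u + v) a = act u a + act v a"
    and act_plus: "a \<in> S \<Longrightarrow> b \<in> S \<Longrightarrow> act u (a + b) = act u a + act u b"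
    and act_mult: "a \<in> S \<Longrightarrow> b \<in> S \<Longrightarrow> act u (a * b) = act (act u a) b"
    and act_one: "act u 1 = u"
begin

lemma S_0: "0 \<in> S" and S_1: "1 \<in> S"
  and S_add: "x \<in> S \<Longrightarrow> y \<in> S \<Longrightarrow> x + y \<in> S"
  and S_mult: "x \<in> S \<Longrightarrow> y \<in> S \<Longrightarrow> x * y \<in> S"
  and S_minus: "x \<in> S \<Longrightarrow> - x \<in> S"
  and S_inverse: "x \<in> S \<Longrightarrow> inverse x \<in> S"
  using S unfolding is_division_subring_def by auto

lemma act_zero_left: "a \<in> S \<Longrightarrow> act 0 a = 0"
  using act_add[of a 0 0] by simp

lemma act_zero_right: "act u 0 = 0"
  using act_plus[OF S_0 S_0, of u] by simp

lemma act_uminus_right: "a \<in> S \<Longrightarrow> act u (- a) = - act u a"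
  using act_plus[of a "- a" u] S_minus[of a] act_zero_right[of u]
  by (simp add: eq_neg_iff_add_eq_0 add.commute)

lemma act_sum: "a \<in> S \<Longrightarrow> act (\<Sum>i\<in>I. f i) a = (\<Sum>i\<in>I. act (f i) a)"
  by (induction I rule: infinite_finite_induct) (simp_all add: act_zero_left act_add)

lemma sub_0: "subspace_over act S A \<Longrightarrow> 0 \<in> A"
  and sub_add: "subspace_over act S A \<Longrightarrow> x \<in> A \<Longrightarrow> y \<in> A \<Longrightarrow> x + y \<in> A"
  and sub_act: "subspace_over act S A \<Longrightarrow> x \<in> A \<Longrightarrow> a \<in> S \<Longrightarrow> act x a \<in> A"
  unfolding subspace_over_def by auto

lemma sub_minus: "subspace_over act S A \<Longrightarrow> x \<in> A \<Longrightarrow> - x \<in> A"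
  using sub_act[of A x "- 1"] S_minus[OF S_1] act_uminus_right[OF S_1] act_one by simp

lemma sub_diff: "subspace_over act S A \<Longrightarrow> x \<in> A \<Longrightarrow> y \<in> A \<Longrightarrow> x - y \<in> A"
  using sub_add[of A x "- y"] sub_minus[of A y] by simp

lemma sub_sum:
  "subspace_over act S A \<Longrightarrow> (\<And>i. i \<in> I \<Longrightarrow> f i \<in> A) \<Longrightarrow> (\<Sum>i\<in>I. f i) \<in> A"
  by (induction I rule: infinite_finite_induct) (auto simp: sub_0 sub_add)

lemma subspace_UNIV: "subspace_over act S UNIV"
  unfolding subspace_over_def by simp

lemma subspace_plus:
  assumes "subspace_over act S A" "subspace_over act S B"
  shows "subspace_over act S {a + b | a b. a \<in> A \<and> b \<in> B}"
  unfolding subspace_over_def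
proof (intro conjI ballI)
  show "0 \<in> {a + b | a b. a \<in> A \<and> b \<in> B}"
    using sub_0[OF assms(1)] sub_0[OF assms(2)] by force
next
  fix x y assume "x \<in> {a + b | a b. a \<in> A \<and> b \<in> B}" "y \<in> {a + b | a b. a \<in> A \<and> b \<in> B}"
  then obtain a b a' b' where "x = a + b" "y = a' + b'" "a \<in> A" "a' \<in> A" "b \<in> B" "b' \<in> B"
    by auto
  then have "x + y = (a + a') + (b + b')" "a + a' \<in> A" "b + b' \<in> B"
    using sub_add[OF assms(1)] sub_add[OF assms(2)] by (auto simp: algebra_simps)
  then show "x + y \<in> {a + b | a b. a \<in> A \<and> b \<in> B}" by blast
next
  fix x c assume "x \<in> {a + b | a b. a \<in> A \<and> b \<in> B}" "c \<in> S"
  then show "act x c \<in> {a + b | a b. a \<in> A \<and> b \<in> B}"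
    using sub_act[OF assms(1)] sub_act[OF assms(2)] act_add by fastforce
qed

lemma lin_span_least: "subspace_over act S A \<Longrightarrow> X \<subseteq> A \<Longrightarrow> lin_span act S X \<subseteq> A"
  unfolding lin_span_def by (auto intro!: sub_sum sub_act)

text \<open>\<open>lin_span\<close> sums over sequences that may repeat vectors, so a further term
  is simply appended. Closure of the span under addition follows by appending term after
  term.\<close>

lemma lin_span_insert_term:
  assumes "y \<in> lin_span act S X" "x \<in> X" "a \<in> S"
  shows "y + act x a \<in> lin_span act S X"
proof -
  obtain n w c where y: "y = (\<Sum>i<n. act (w i) (c i))" and wc: "\<forall>i<(n::nat). w i \<in> X \<and> c i \<in> S"
    using assms(1) unfolding lin_span_def by auto
  have "y + act x a = (\<Sum>i<Suc n. act ((w(n := x)) i) ((c(n := a)) i))"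
    unfolding y sum.lessThan_Suc by (intro arg_cong2[where f = "(+)"] sum.cong) auto
  moreover have "\<forall>i<Suc n. (w(n := x)) i \<in> X \<and> (c(n := a)) i \<in> S"
    using wc assms by (auto simp: less_Suc_eq)
  ultimately show ?thesis unfolding lin_span_def by blast
qed

lemma lin_span_0: "0 \<in> lin_span act S X"
  unfolding lin_span_def by (auto intro!: exI[of _ "0::nat"])

lemma lin_span_subspace: "subspace_over act S (lin_span act S X)"
  unfolding subspace_over_def
proof (intro conjI ballI)
  show "0 \<in> lin_span act S X" by (rule lin_span_0)
next
  fix x y assume x: "x \<in> lin_span act S X" and "y \<in> lin_span act S X"
  then obtain n w c where y: "y = (\<Sum>i<n. act (w i) (c i))" and wc: "\<forall>i<(n::nat). w i \<in> X \<and> c i \<in> S"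
    unfolding lin_span_def by auto
  have "k \<le> n \<Longrightarrow> x + (\<Sum>i<k. act (w i) (c i)) \<in> lin_span act S X" for k
  proof (induction k)
    case (Suc k)
    then show ?case using lin_span_insert_term[of "x + (\<Sum>i<k. act (w i) (c i))" X "w k" "c k"] wc
      by (simp add: add.assoc)
  qed (simp add: x)
  then show "x + y \<in> lin_span act S X" unfolding y by simp
next
  fix x a assume "x \<in> lin_span act S X" and a: "a \<in> S"
  then obtain n w c where x: "x = (\<Sum>i<n. act (w i) (c i))" and wc: "\<forall>i<(n::nat). w i \<in> X \<and> c i \<in> S"
    unfolding lin_span_def by auto
  have "act x a = (\<Sum>i<n. act (w i) (c i * a))"
    unfolding x act_sum[OF a] using wc a by (intro sum.cong) (auto simp: act_mult)
  moreover have "\<forall>i<n. w i \<in> X \<and> c i * a \<in> S" using wc a S_mult by auto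
  ultimately show "act x a \<in> lin_span act S X"
    unfolding lin_span_def by (auto intro!: exI[of _ n] exI[of _ w] exI[of _ "\<lambda>i. c i * a"])
qed

lemma lin_span_superset: "X \<subseteq> lin_span act S X"
  using lin_span_insert_term[OF lin_span_0 _ S_1, of _ X] act_one by auto

lemma lin_span_mono: "X \<subseteq> Y \<Longrightarrow> lin_span act S X \<subseteq> lin_span act S Y"
  using lin_span_least[OF lin_span_subspace, of X Y] lin_span_superset[of Y] by auto

lemma lin_span_insert:
  "lin_span act S (insert x X) = {y + act x a | y a. y \<in> lin_span act S X \<and> a \<in> S}"
    (is "?L = ?R")
proof
  have "subspace_over act S ?R"
    unfolding subspace_over_def
  proof (intro conjI ballI)
    show "0 \<in> ?R" using lin_span_0[of X] S_0 act_zero_right[of x] by force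
  next
    fix y z assume "y \<in> ?R" "z \<in> ?R"
    then obtain y' a z' b where *: "y = y' + act x a" "z = z' + act x b"
      "y' \<in> lin_span act S X" "z' \<in> lin_span act S X" "a \<in> S" "b \<in> S" by auto
    then have "y + z = (y' + z') + act x (a + b)" by (simp add: act_plus algebra_simps)
    moreover have "y' + z' \<in> lin_span act S X" "a + b \<in> S"
      using * sub_add[OF lin_span_subspace] S_add by auto
    ultimately show "y + z \<in> ?R" by blast
  next
    fix y b assume "y \<in> ?R" and b: "b \<in> S"
    then obtain y' a where *: "y = y' + act x a" "y' \<in> lin_span act S X" "a \<in> S" by auto
    then have "act y b = act y' b + act x (a * b)" using b by (simp add: act_add act_mult)
    moreover have "act y' b \<in> lin_span act S X" "a * b \<in> S"
      using * b sub_act[OF lin_span_subspace] S_mult by auto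
    ultimately show "act y b \<in> ?R" by blast
  qed
  moreover have "insert x X \<subseteq> ?R"
  proof -
    have "x \<in> ?R" using lin_span_0[of X] S_1 act_one[of x] by force
    moreover have "y \<in> ?R" if "y \<in> X" for y
    proof -
      have "y = y + act x 0" by (simp add: act_zero_right)
      then show ?thesis using that lin_span_superset[of X] S_0 by blast
    qed
    ultimately show ?thesis by auto
  qed
  ultimately show "?L \<subseteq> ?R" by (rule lin_span_least)
  show "?R \<subseteq> ?L"
    using lin_span_mono[of X "insert x X"] lin_span_insert_term[of _ "insert x X" x] by auto
qed

section \<open>Finite generation, maximal members, bases and double orthogonals\<close>

lemma lin_span_empty: "lin_span act S {} = {0}"
  using lin_span_least[of "{0}" "{}"] lin_span_0[of "{}"] act_zero_left
  unfolding subspace_over_def by auto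

text \<open>Induction on the spanning set. The part of \<open>A\<close> inside the span of
  \<open>X\<close> is finitely generated; if \<open>A\<close> is larger, one further
  \<open>a\<close> in \<open>A\<close> with nonzero coefficient at \<open>x\<close> suffices, since
  subtracting a multiple of it moves any vector of \<open>A\<close> into the span of
  \<open>X\<close>.\<close>

lemma subspace_finitely_spanned:
  assumes "finite X" "subspace_over act S A" "A \<subseteq> lin_span act S X"
  shows "\<exists>Y. finite Y \<and> Y \<subseteq> A \<and> lin_span act S Y = A"
  using assms
proof (induction X arbitrary: A rule: finite_induct)
  case empty
  then have "A = {0}" using lin_span_empty sub_0 by blast
  then show ?case using lin_span_empty by (intro exI[of _ "{}"]) auto
next
  case (insert x X)
  let ?L = "lin_span act S X"
  have sub: "subspace_over act S (A \<inter> ?L)"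
    using insert.prems(1) lin_span_subspace[of X] unfolding subspace_over_def by blast
  then obtain Y where Y: "finite Y" "Y \<subseteq> A \<inter> ?L" "lin_span act S Y = A \<inter> ?L"
    using insert.IH[OF sub] by auto
  show ?case
  proof (cases "A \<subseteq> ?L")
    case True
    then show ?thesis using Y by (intro exI[of _ Y]) auto
  next
    case False
    then obtain a where a: "a \<in> A" "a \<notin> ?L" by auto
    then obtain y c where ay: "a = y + act x c" "y \<in> ?L" "c \<in> S"
      using insert.prems(2) unfolding lin_span_insert by blast
    have c0: "c \<noteq> 0" using a ay act_zero_right by auto
    have "A \<subseteq> lin_span act S (insert a Y)"
    proof
      fix z assume z: "z \<in> A"
      then obtain y' c' where zy: "z = y' + act x c'" "y' \<in> ?L" "c' \<in> S"
        using insert.prems(2) unfolding lin_span_insert by blast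
      \<comment> \<open>The scalar for which \<open>act a ?e\<close> has the same coefficient at
        \<open>x\<close> as \<open>z\<close>.\<close>
      let ?e = "inverse c * c'"
      have e: "?e \<in> S" using ay zy S_mult S_inverse by auto
      have "act a ?e = act y ?e + act x (c * ?e)"
        using ay e by (simp add: act_add act_mult)
      also have "c * ?e = c'" using c0 by (simp flip: mult.assoc)
      finally have "z - act a ?e = y' - act y ?e" using zy by simp
      moreover have "y' - act y ?e \<in> ?L"
        using sub_diff[OF lin_span_subspace zy(2) sub_act[OF lin_span_subspace ay(2) e]] .
      moreover have "z - act a ?e \<in> A"
        using sub_diff[OF insert.prems(1) z sub_act[OF insert.prems(1) a(1) e]] .
      ultimately have "z - act a ?e \<in> lin_span act S Y" using Y by auto
      then have "(z - act a ?e) + act a ?e \<in> lin_span act S (insert a Y)"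
        unfolding lin_span_insert using e by blast
      then show "z \<in> lin_span act S (insert a Y)" by simp
    qed
    moreover have "lin_span act S (insert a Y) \<subseteq> A"
      using lin_span_least[OF insert.prems(1)] a Y by auto
    ultimately show ?thesis using Y a by (intro exI[of _ "insert a Y"]) auto
  qed
qed

text \<open>Zorn's lemma applies to an arbitrary property of subspaces: the union of a chain is a
  subspace, hence finitely generated, and its generators already lie in one member of the chain,
  which is therefore the union.\<close>

lemma maximal_subspace_exists:
  assumes fin: "finite X" "lin_span act S X = UNIV"
    and sub: "\<And>A. Q A \<Longrightarrow> subspace_over act S A" and ne: "Q A0"
  shows "\<exists>A. Q A \<and> (\<forall>B. Q B \<longrightarrow> A \<subseteq> B \<longrightarrow> B = A)"
proof -
  have "\<exists>M\<in>Collect Q. \<forall>B\<in>Collect Q. M \<subseteq> B \<longrightarrow> B = M"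
  proof (rule subset_Zorn_nonempty)
    show "Collect Q \<noteq> {}" using ne by auto
  next
    fix \<C> assume ne: "\<C> \<noteq> {}" and ch: "subset.chain (Collect Q) \<C>"
    have Q: "A \<in> \<C> \<Longrightarrow> Q A" for A using ch unfolding subset.chain_def by auto
    have tot: "A \<in> \<C> \<Longrightarrow> B \<in> \<C> \<Longrightarrow> A \<subseteq> B \<or> B \<subseteq> A" for A B
      using subset.chain_total[OF ch] by auto
    have "subspace_over act S (\<Union>\<C>)"
      unfolding subspace_over_def
    proof (intro conjI ballI)
      show "0 \<in> \<Union>\<C>" using ne Q sub sub_0 by blast
    next
      fix x y assume "x \<in> \<Union>\<C>" "y \<in> \<Union>\<C>"
      then obtain A B where "A \<in> \<C>" "B \<in> \<C>" "x \<in> A" "y \<in> B" by auto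
      then obtain C where "C \<in> \<C>" "x \<in> C" "y \<in> C" using tot by blast
      then show "x + y \<in> \<Union>\<C>" using Q sub sub_add by blast
    next
      fix x a assume "x \<in> \<Union>\<C>" "a \<in> S"
      then show "act x a \<in> \<Union>\<C>" using Q sub sub_act by blast
    qed
    then obtain Y where Y: "finite Y" "Y \<subseteq> \<Union>\<C>" "lin_span act S Y = \<Union>\<C>"
      using subspace_finitely_spanned[OF fin(1)] fin(2) by (metis subset_UNIV)
    have "\<exists>C\<in>\<C>. Y \<subseteq> C"
      using finite_subset_Union_chain[OF Y(1,2) ne] tot ch
      by (metis subset.chain_def subset_chain_def)
    then obtain C where C: "C \<in> \<C>" "Y \<subseteq> C" by blast
    then have "\<Union>\<C> \<subseteq> C" using Y lin_span_least[OF sub[OF Q]] by blast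
    then have "\<Union>\<C> = C" using C by auto
    then show "\<Union>\<C> \<in> Collect Q" using C Q by simp
  qed
  then show ?thesis by auto
qed

text \<open>A spanning set of least cardinality is independent: a vector with a nonzero coefficient
  in a relation lies in the span of the others and could be dropped.\<close>

lemma basis_exists:
  assumes "finite X" "lin_span act S X = A"
  shows "\<exists>B m. inj_on B {..<m::nat} \<and> B ` {..<m} \<subseteq> A \<and>
     lin_indep act S (B ` {..<m}) \<and> lin_span act S (B ` {..<m}) = A"
proof -
  define n where "n = (LEAST n. \<exists>Y. finite Y \<and> lin_span act S Y = A \<and> card Y = n)"
  have "\<exists>Y. finite Y \<and> lin_span act S Y = A \<and> card Y = n"
    unfolding n_def by (rule LeastI_ex) (use assms in blast)
  then obtain Y where Y: "finite Y" "lin_span act S Y = A" "card Y = n" by auto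
  have min: "n \<le> card Z" if "finite Z" "lin_span act S Z = A" for Z
    unfolding n_def using that by (intro Least_le) auto
  have "lin_indep act S Y"
    unfolding lin_indep_def
  proof (intro allI impI, elim conjE)
    fix k :: nat and w c i
    assume wc: "\<forall>i<k. w i \<in> Y \<and> c i \<in> S" and inj: "inj_on w {..<k}"
      and s0: "(\<Sum>i<k. act (w i) (c i)) = 0" and i: "i < k"
    show "c i = 0"
    proof (rule ccontr)
      assume ci: "c i \<noteq> 0"
      let ?Z = "Y - {w i}"
      have "(\<Sum>j<k. act (w j) (c j)) = act (w i) (c i) + (\<Sum>j\<in>{..<k} - {i}. act (w j) (c j))"
        using i by (simp add: sum.remove)
      then have "act (w i) (c i) = - (\<Sum>j\<in>{..<k} - {i}. act (w j) (c j))"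
        using s0 by (simp add: eq_neg_iff_add_eq_0)
      moreover have "(\<Sum>j\<in>{..<k} - {i}. act (w j) (c j)) \<in> lin_span act S ?Z"
      proof (rule sub_sum[OF lin_span_subspace])
        fix j assume j: "j \<in> {..<k} - {i}"
        then have "w j \<in> ?Z" using wc inj i unfolding inj_on_def by auto
        then show "act (w j) (c j) \<in> lin_span act S ?Z"
          using sub_act[OF lin_span_subspace] lin_span_superset[of ?Z] wc j by auto
      qed
      ultimately have *: "act (w i) (c i) \<in> lin_span act S ?Z"
        using sub_minus[OF lin_span_subspace] by simp
      have "w i = act (act (w i) (c i)) (inverse (c i))"
        using wc i ci by (simp add: S_inverse act_one flip: act_mult)
      then have "w i \<in> lin_span act S ?Z"
        using sub_act[OF lin_span_subspace * S_inverse[of "c i"]] wc i by simp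
      then have "Y \<subseteq> lin_span act S ?Z" using lin_span_superset[of ?Z] by auto
      then have "lin_span act S ?Z = A"
        using lin_span_least[OF lin_span_subspace] lin_span_mono[of ?Z Y] Y by blast
      then have "n \<le> card ?Z" using min Y by simp
      moreover have "card ?Z < card Y" using Y wc i by (intro psubset_card_mono) auto
      ultimately show False using Y by simp
    qed
  qed
  moreover obtain B where "bij_betw B {0..<card Y} Y" using ex_bij_betw_nat_finite[OF Y(1)] by auto
  ultimately show ?thesis using Y lin_span_superset[of Y]
    by (intro exI[of _ B] exI[of _ "card Y"]) (auto simp: bij_betw_def lessThan_atLeast0)
qed

text \<open>Only the subspace has to be finitely generated: a functional that vanishes on the common
  kernel of finitely many functionals is a combination of them.\<close>

lemma double_orthogonal:
  assumes fin: "finite X" and S_central: "S \<subseteq> centre"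
    and val: "\<And>x y. b x y \<in> S"
    and addl: "\<And>x y z. b (x + y) z = b x z + b y z" and addr: "\<And>x y z. b x (y + z) = b x y + b x z"
    and actl: "\<And>x y c. c \<in> S \<Longrightarrow> b (act x c) y = c * b x y"
    and actr: "\<And>x y c. c \<in> S \<Longrightarrow> b x (act y c) = c * b x y"
    and nondeg: "\<And>y. (\<And>x. b x y = 0) \<Longrightarrow> y = 0"
    and v: "\<And>x. (\<And>a. a \<in> lin_span act S X \<Longrightarrow> b x a = 0) \<Longrightarrow> b x v = 0"
  shows "v \<in> lin_span act S X"
proof -
  have comm: "c * y = y * c" if "c \<in> S" for c y using that S_central unfolding centre_def by auto
  have b0: "b x 0 = 0" for x using addr[of x 0 0] by simp
  have bm: "b x (- y) = - b x y" for x y using addr[of x y "- y"] b0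
    by (simp add: eq_neg_iff_add_eq_0 add.commute)
  have bd: "b x (y - z) = b x y - b x z" for x y z using addr[of x y "- z"] bm by simp
  have b0l: "b 0 x = 0" for x using addl[of 0 0 x] by simp
  have bml: "b (- y) x = - b y x" for x y using addl[of y "- y" x] b0l
    by (simp add: eq_neg_iff_add_eq_0 add.commute)
  have bdl: "b (y - z) x = b y x - b z x" for x y z using addl[of y "- z" x] bml by simp
  have span: "b x a = 0" if "\<And>a. a \<in> X \<Longrightarrow> b x a = 0" "a \<in> lin_span act S X" for x a X
  proof -
    have "subspace_over act S {a. b x a = 0}"
      unfolding subspace_over_def using b0 addr actr by auto
    then show ?thesis using lin_span_least[of "{a. b x a = 0}" X] that by auto
  qed
  have "v \<in> lin_span act S X" if "\<And>x. (\<And>a. a \<in> X \<Longrightarrow> b x a = 0) \<Longrightarrow> b x v = 0" for v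
    using fin that
  proof (induction X arbitrary: v rule: finite_induct)
    case empty
    then show ?case using nondeg lin_span_empty by auto
  next
    case (insert a X)
    show ?case
    proof (cases "\<forall>x. (\<forall>a\<in>X. b x a = 0) \<longrightarrow> b x a = 0")
      case True
      then have "b x v = 0" if "\<And>a. a \<in> X \<Longrightarrow> b x a = 0" for x
        using insert.prems[of x] that by auto
      then have "v \<in> lin_span act S X" by (rule insert.IH)
      then show ?thesis using lin_span_mono[of X "insert a X"] by auto
    next
      case False
      then obtain x0 where x0: "\<forall>a\<in>X. b x0 a = 0" "b x0 a \<noteq> 0" by auto
      \<comment> \<open>Scaled so that \<open>x1\<close> is orthogonal to \<open>X\<close> and pairs
        to 1 with \<open>a\<close>. A vector \<open>x\<close> orthogonal to \<open>X\<close> becomes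
        orthogonal to \<open>a\<close> as well after subtracting \<open>act x1 (b x a)\<close>, and
        \<open>c\<close> below is the coefficient at \<open>a\<close> to be removed from
        \<open>v\<close>.\<close>
      define x1 where "x1 = act x0 (inverse (b x0 a))"
      have iS: "inverse (b x0 a) \<in> S" using val S_inverse by auto
      have x1: "\<forall>a\<in>X. b x1 a = 0" "b x1 a = 1"
        unfolding x1_def using x0 actl[OF iS] by auto
      define c where "c = b x1 v"
      have cS: "c \<in> S" unfolding c_def by (rule val)
      have "v - act a c \<in> lin_span act S X"
      proof (rule insert.IH)
        fix x assume x: "\<And>a. a \<in> X \<Longrightarrow> b x a = 0"
        have "b (x - act x1 (b x a)) v = 0"
          by (rule insert.prems) (use x x1 actl[OF val] bdl in auto)
        then have "b x v = b x a * c" using actl[OF val] bdl unfolding c_def by simp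
        then show "b x (v - act a c) = 0" using bd actr[OF cS] comm[OF cS] by simp
      qed
      then have "(v - act a c) + act a c \<in> lin_span act S (insert a X)"
        unfolding lin_span_insert using cS by blast
      then show ?thesis by simp
    qed
  qed
  then show ?thesis using v span by blast
qed

end

section \<open>Hermitian spaces over a quadratic extension\<close>

locale quadratic_herm =
  fixes F K D :: "'e::division_ring set"
    and \<theta> \<sigma> :: "'e \<Rightarrow> 'e" and lam :: 'e
    and sm :: "'v::ab_group_add \<Rightarrow> 'e \<Rightarrow> 'v" and h :: "'v \<Rightarrow> 'v \<Rightarrow> 'e"
    and \<alpha> :: 'e
  assumes F_field: "is_subfield F"
    and K_field: "is_subfield K" and FK: "F \<subseteq> K" and K_central: "K \<subseteq> centre"
    and \<alpha>_K: "\<alpha> \<in> K" and \<alpha>_F: "\<alpha> \<notin> F" and K_span: "lin_span (*) F {1, \<alpha>} = K"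
    and D_div: "is_division_subring D" and FD: "F \<subseteq> D"
    and D_fin: "\<exists>X. finite X \<and> X \<subseteq> D \<and> lin_span (*) F X = D"
    and DK: "scalar_ext_iso (*) F K D UNIV"
    and inv: "involution_first_kind D \<theta>"
    and sig: "is_theta_K D K \<theta> \<sigma>"
    and lam: "lam = 1 \<or> lam = -1"
    and herm: "herm_space UNIV \<sigma> lam UNIV sm h"
    and reg: "herm_regular UNIV h"
    and even: "herm_even UNIV \<sigma> lam UNIV h"
begin

lemma sm_rules: "sm (u + v) a = sm u a + sm v a" "sm u (a + b) = sm u a + sm u b"
    "sm u (a * b) = sm (sm u a) b" "sm u 1 = u"
  using herm unfolding herm_space_def by auto

text \<open>In each prefix the first letter names the scalars (\<open>E\<close> for the whole
  ambient ring), the second the space acted on: \<open>V\<close> for the hermitian space,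
  \<open>E\<close> for the ambient ring under multiplication.\<close>

sublocale FV: scalars F sm
  by unfold_locales (use F_field sm_rules in \<open>auto simp: is_subfield_def is_division_subring_def\<close>)

sublocale FE: scalars F "(*)"
  by unfold_locales (use F_field in \<open>auto simp: is_subfield_def is_division_subring_def algebra_simps\<close>)

sublocale KV: scalars K sm
  by unfold_locales (use K_field sm_rules in \<open>auto simp: is_subfield_def is_division_subring_def\<close>)

sublocale KE: scalars K "(*)"
  by unfold_locales (use K_field in \<open>auto simp: is_subfield_def is_division_subring_def algebra_simps\<close>)

sublocale DV: scalars D sm
  by unfold_locales (use D_div sm_rules in \<open>auto simp: is_division_subring_def\<close>)

sublocale EV: scalars UNIV sm
  by unfold_locales (use sm_rules in \<open>auto simp: is_division_subring_def\<close>)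

lemma K_comm: "k \<in> K \<Longrightarrow> k * x = x * k"
  using K_central unfolding centre_def by auto

lemma F_central: "F \<subseteq> centre"
  using FK K_central by auto

section \<open>Coordinates with respect to 1 and \<alpha>\<close>

lemma K_decomp:
  assumes "k \<in> K" obtains f g where "f \<in> F" "g \<in> F" "k = f + g * \<alpha>"
proof -
  have "k \<in> lin_span (*) F (insert 1 (insert \<alpha> {}))" using assms K_span by simp
  then obtain f g where "k = \<alpha> * f + g" "f \<in> F" "g \<in> F"
    unfolding FE.lin_span_insert FE.lin_span_empty by auto
  then show thesis using that[of g f] K_comm[OF \<alpha>_K] by (simp add: add.commute)
qed

text \<open>A multiple \<open>act w k\<close> with \<open>k = f + g * \<alpha>\<close> equals
  \<open>act w f + act (act w g) \<alpha>\<close>, so the sums on the right are closed under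
  \<open>K\<close>. The action is left general because this is applied both to \<open>D\<close>
  inside the ambient ring and to \<open>F\<close>-structures of the hermitian space.\<close>

lemma lin_span_K:
  assumes K: "scalars K act" and F: "scalars F act" and W: "subspace_over act F W"
  shows "lin_span act K W = {w + act w' \<alpha> | w w'. w \<in> W \<and> w' \<in> W}" (is "_ = ?Z")
proof
  interpret K: scalars K act by (rule K)
  interpret F: scalars F act by (rule F)
  have add: "x + y \<in> ?Z" if xy: "x \<in> ?Z" "y \<in> ?Z" for x y
  proof -
    obtain a b c d where *: "x = a + act b \<alpha>" "y = c + act d \<alpha>" "a \<in> W" "b \<in> W" "c \<in> W" "d \<in> W"
      using xy by auto
    then have "x + y = (a + c) + act (b + d) \<alpha>" using K.act_add[OF \<alpha>_K] by (simp add: algebra_simps)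
    then show ?thesis using F.sub_add[OF W] * by blast
  qed
  have scal: "act w k \<in> ?Z" if wk: "w \<in> W" "k \<in> K" for w k
  proof -
    obtain f g where *: "f \<in> F" "g \<in> F" "k = f + g * \<alpha>" using K_decomp[OF wk(2)] .
    then have "g * \<alpha> \<in> K" "f \<in> K" "g \<in> K" using FK K.S_mult \<alpha>_K by auto
    then have "act w k = act w f + act (act w g) \<alpha>"
      using * by (simp add: K.act_plus K.act_mult \<alpha>_K)
    then show ?thesis using F.sub_act[OF W] * wk by blast
  qed
  have "subspace_over act K ?Z"
    unfolding subspace_over_def
  proof (intro conjI ballI)
    show "0 \<in> ?Z" using F.sub_0[OF W] K.act_zero_left[OF \<alpha>_K] by force
  next
    fix x k assume "x \<in> ?Z" and k: "k \<in> K"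
    then obtain a b where *: "x = a + act b \<alpha>" "a \<in> W" "b \<in> W" by auto
    then have "act x k = act a k + act b (\<alpha> * k)"
      using k by (simp add: K.act_add K.act_mult \<alpha>_K)
    then show "act x k \<in> ?Z" using add[OF scal scal] * k K.S_mult[OF \<alpha>_K k] by simp
  qed (rule add)
  moreover have "W \<subseteq> ?Z"
  proof
    fix w assume "w \<in> W"
    then show "w \<in> ?Z" using scal[of w 1] K.S_1 K.act_one[of w] by simp
  qed
  ultimately show "lin_span act K W \<subseteq> ?Z" by (rule K.lin_span_least)
  show "?Z \<subseteq> lin_span act K W"
    using K.lin_span_superset[of W] K.sub_act[OF K.lin_span_subspace _ \<alpha>_K]
      K.sub_add[OF K.lin_span_subspace] by blast
qed

lemma D_0: "0 \<in> D" and D_1: "1 \<in> D" and D_add: "x \<in> D \<Longrightarrow> y \<in> D \<Longrightarrow> x + y \<in> D"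
  and D_mult: "x \<in> D \<Longrightarrow> y \<in> D \<Longrightarrow> x * y \<in> D" and D_minus: "x \<in> D \<Longrightarrow> - x \<in> D"
  and D_inverse: "x \<in> D \<Longrightarrow> inverse x \<in> D"
  using D_div unfolding is_division_subring_def by auto

lemma D_diff: "x \<in> D \<Longrightarrow> y \<in> D \<Longrightarrow> x - y \<in> D"
  using D_add[of x "- y"] D_minus by simp

lemma D_subspace: "subspace_over (*) F D"
  unfolding subspace_over_def using D_0 D_add D_mult FD by auto

lemma E_decomp:
  obtains d d' where "d \<in> D" "d' \<in> D" "e = d + d' * \<alpha>"
proof -
  have "e \<in> lin_span (*) K D" using DK unfolding scalar_ext_iso_def by auto
  then show thesis
    using that lin_span_K[OF KE.scalars_axioms FE.scalars_axioms D_subspace] by auto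
qed

text \<open>If \<alpha> were in \<open>D\<close>, then 1 and \<alpha> would be an
  \<open>F\<close>-independent family in \<open>D\<close>, hence \<open>K\<close>-independent by
  \<open>DK\<close>. But \<alpha> is itself a scalar of \<open>K\<close>, which gives a
  relation.\<close>

lemma \<alpha>_D: "\<alpha> \<notin> D"
proof
  assume \<alpha>D: "\<alpha> \<in> D"
  have "lin_indep (*) F {1, \<alpha>}"
    unfolding lin_indep_def
  proof (intro allI impI, elim conjE)
    fix n :: nat and w c i
    assume wc: "\<forall>i<n. w i \<in> {1, \<alpha>} \<and> c i \<in> F" and inj: "inj_on w {..<n}"
      and s0: "(\<Sum>i<n. w i * c i) = 0" and i: "i < n"
    have ne: "\<alpha> * g \<noteq> f" if "g \<noteq> 0" "f \<in> F" "g \<in> F" for f g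
    proof
      assume "\<alpha> * g = f"
      then have "\<alpha> = f * inverse g" using that by (simp add: mult.assoc flip: \<open>\<alpha> * g = f\<close>)
      then show False using \<alpha>_F that FE.S_mult FE.S_inverse by auto
    qed
    show "c i = 0"
    proof (rule ccontr)
      assume ci: "c i \<noteq> 0"
      have s: "w i * c i + (\<Sum>j\<in>{..<n} - {i}. w j * c j) = 0"
        using s0 i by (simp add: sum.remove)
      show False
      proof (cases "w i = 1")
        case True
        \<comment> \<open>As \<open>w\<close> is injective with values in a two-element set, every
          other index carries the other vector.\<close>
        then have "w j = \<alpha>" if "j \<in> {..<n} - {i}" for j
          using wc inj i that unfolding inj_on_def by (metis DiffE insertE insertI1 lessThan_iff singletonD)
        then have "c i + \<alpha> * (\<Sum>j\<in>{..<n} - {i}. c j) = 0"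
          using s True by (simp add: sum_distrib_left)
        moreover have "(\<Sum>j\<in>{..<n} - {i}. c j) \<in> F"
          using wc FE.sub_sum[of F "{..<n} - {i}" c] FE.S_0 FE.S_add FE.S_mult
          unfolding subspace_over_def by auto
        ultimately show False
          using ne[of "\<Sum>j\<in>{..<n} - {i}. c j" "- c i"] ci wc i FE.S_minus
          by (cases "(\<Sum>j\<in>{..<n} - {i}. c j) = 0") (auto simp: eq_neg_iff_add_eq_0 add.commute)
      next
        case False
        then have wi: "w i = \<alpha>" using wc i by auto
        then have "w j = 1" if "j \<in> {..<n} - {i}" for j
          using wc inj i that unfolding inj_on_def by (metis DiffE insertE insertI1 lessThan_iff singletonD)
        then have "\<alpha> * c i + (\<Sum>j\<in>{..<n} - {i}. c j) = 0"
          using s wi by simp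
        moreover have "(\<Sum>j\<in>{..<n} - {i}. c j) \<in> F"
          using wc FE.sub_sum[of F "{..<n} - {i}" c] FE.S_0 FE.S_add FE.S_mult
          unfolding subspace_over_def by auto
        ultimately show False
          using ne[of "c i" "- (\<Sum>j\<in>{..<n} - {i}. c j)"] ci wc i FE.S_minus
          by (auto simp: eq_neg_iff_add_eq_0)
      qed
    qed
  qed
  then have indep: "lin_indep (*) K {1, \<alpha>}"
    using DK \<alpha>D D_1 unfolding scalar_ext_iso_def by auto
  \<comment> \<open>The \<open>K\<close>-relation
    \<open>1 * \<alpha> + \<alpha> * (- 1) = 0\<close>.\<close>
  let ?w = "\<lambda>i::nat. if i = 0 then 1 else \<alpha>" and ?c = "\<lambda>i::nat. if i = 0 then \<alpha> else - 1"
  have "\<alpha> \<noteq> 1" using \<alpha>_F FE.S_1 by auto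
  then have "inj_on ?w {..<2}" by (auto simp: inj_on_def less_2_cases_iff)
  moreover have "(\<Sum>i<2. ?w i * ?c i) = 0" by (simp add: numeral_2_eq_2)
  moreover have "\<forall>i<2. ?w i \<in> {1, \<alpha>} \<and> ?c i \<in> K" using \<alpha>_K KE.S_minus[OF KE.S_1] by auto
  ultimately have "?c 1 = 0"
    using indep[unfolded lin_indep_def, rule_format, of 2 ?w ?c 1] by auto
  then show False by simp
qed

lemma decomp_0:
  assumes "d \<in> D" "d' \<in> D" "d + d' * \<alpha> = 0"
  shows "d = 0 \<and> d' = 0"
proof -
  have "d' = 0"
  proof (rule ccontr)
    assume n: "d' \<noteq> 0"
    have "d' * \<alpha> = - d" using assms by (simp add: eq_neg_iff_add_eq_0 add.commute)
    then have "inverse d' * (d' * \<alpha>) = - (inverse d' * d)" by simp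
    then have "\<alpha> = - (inverse d' * d)" using n by (simp flip: mult.assoc)
    then show False using \<alpha>_D assms D_mult D_minus D_inverse by auto
  qed
  then show ?thesis using assms by simp
qed

lemma decomp_unique:
  assumes "d + d' * \<alpha> = c + c' * \<alpha>" "d \<in> D" "d' \<in> D" "c \<in> D" "c' \<in> D"
  shows "d = c \<and> d' = c'"
proof -
  have "(d - c) + (d' - c') * \<alpha> = 0" using assms by (simp add: algebra_simps)
  then show ?thesis using decomp_0[of "d - c" "d' - c'"] assms D_diff by auto
qed

text \<open>Left \<open>D\<close>-linear with kernel \<open>D\<close>. It maps \<open>K\<close> to
  \<open>F\<close>, so composing with it turns \<open>K\<close>-valued forms into
  \<open>F\<close>-valued ones.\<close>

definition im :: "'e \<Rightarrow> 'e" where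
  "im e = (THE d'. d' \<in> D \<and> (\<exists>d\<in>D. e = d + d' * \<alpha>))"

lemma im_eq: "d \<in> D \<Longrightarrow> d' \<in> D \<Longrightarrow> im (d + d' * \<alpha>) = d'"
  unfolding im_def using decomp_unique by (intro the_equality) blast+

lemma im_D: "d \<in> D \<Longrightarrow> im d = 0"
  using im_eq[of d 0] D_0 by simp

lemma im_D_\<alpha>: "d \<in> D \<Longrightarrow> im (\<alpha> * d) = d"
  using im_eq[of 0 d] D_0 K_comm[OF \<alpha>_K] by simp

lemma im_add: "im (x + y) = im x + im y"
proof -
  obtain a b where x: "a \<in> D" "b \<in> D" "x = a + b * \<alpha>" by (rule E_decomp)
  obtain c d where y: "c \<in> D" "d \<in> D" "y = c + d * \<alpha>" by (rule E_decomp)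
  have "x + y = (a + c) + (b + d) * \<alpha>" using x y by (simp add: algebra_simps)
  then have "im (x + y) = b + d" using im_eq x y D_add by metis
  then show ?thesis using im_eq x y by simp
qed

lemma im_mult: "d \<in> D \<Longrightarrow> im (d * x) = d * im x"
proof -
  assume d: "d \<in> D"
  obtain a b where x: "a \<in> D" "b \<in> D" "x = a + b * \<alpha>" by (rule E_decomp)
  have "d * x = d * a + (d * b) * \<alpha>" using x by (simp add: algebra_simps)
  then have "im (d * x) = d * b" using im_eq x d D_mult by metis
  then show ?thesis using im_eq x by simp
qed

lemma im_K: "k \<in> K \<Longrightarrow> im k \<in> F"
  using K_decomp[of k] im_eq FD by (metis subsetD)

section \<open>The involution, the hermitian form and the trace map\<close>

lemma \<theta>_D: "x \<in> D \<Longrightarrow> \<theta> x \<in> D"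
  and \<theta>_\<theta>: "x \<in> D \<Longrightarrow> \<theta> (\<theta> x) = x"
  and \<theta>_central: "z \<in> D \<Longrightarrow> (\<And>x. x \<in> D \<Longrightarrow> z * x = x * z) \<Longrightarrow> \<theta> z = z"
  using inv unfolding involution_first_kind_def by auto

lemma \<sigma>_add: "\<sigma> (x + y) = \<sigma> x + \<sigma> y"
  and \<sigma>_mult: "d \<in> D \<Longrightarrow> k \<in> K \<Longrightarrow> \<sigma> (d * k) = \<theta> d * k"
  using sig unfolding is_theta_K_def by auto

lemma \<sigma>_D: "d \<in> D \<Longrightarrow> \<sigma> d = \<theta> d"
  using \<sigma>_mult[of d 1] KE.S_1 by simp

lemma \<sigma>_0: "\<sigma> 0 = 0"
  using \<sigma>_add[of 0 0] by simp

lemma \<theta>_1: "\<theta> 1 = 1"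
  using \<theta>_central[OF D_1] by simp

lemma \<sigma>_K: "k \<in> K \<Longrightarrow> \<sigma> k = k"
  using \<sigma>_mult[OF D_1, of k] \<theta>_1 by simp

lemma \<sigma>_decomp: "d \<in> D \<Longrightarrow> d' \<in> D \<Longrightarrow> \<sigma> (d + d' * \<alpha>) = \<theta> d + \<theta> d' * \<alpha>"
  using \<sigma>_add \<sigma>_D \<sigma>_mult \<alpha>_K by simp

lemma lam_F: "lam \<in> F"
  using lam FE.S_1 FE.S_minus by auto

lemma lam_K: "lam \<in> K" and lam_D: "lam \<in> D"
  using lam_F FK FD by auto

lemma lam_lam: "lam * lam = 1" "lam * (lam * x) = x"
  using lam by auto

lemma h_add: "h (u + u') v = h u v + h u' v" "h v (u + u') = h v u + h v u'"
  and h_act: "h (sm u a) (sm v b) = \<sigma> a * h u v * b"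
  and h_sym: "h v u = lam * \<sigma> (h u v)"
  using herm unfolding herm_space_def by blast+

lemma h_actr: "h u (sm v b) = h u v * b"
  using h_act[of u 1 v b] sm_rules(4) \<sigma>_K[OF KE.S_1] by simp

lemma h_actl: "h (sm u a) v = \<sigma> a * h u v"
  using h_act[of u a v 1] sm_rules(4) by simp

lemma h_0: "h 0 v = 0" "h v 0 = 0"
  using h_add(1)[of 0 0 v] h_add(2)[of v 0 0] by auto

lemma h_uminus: "h (- u) v = - h u v" "h v (- u) = - h v u"
  using h_add(1)[of u "- u" v] h_add(2)[of v u "- u"] h_0 by (auto simp: eq_neg_iff_add_eq_0 add.commute)

lemma h_diff: "h (u - u') v = h u v - h u' v" "h v (u - u') = h v u - h v u'"
  using h_add(1)[of u "- u'" v] h_add(2)[of v u "- u'"] h_uminus by auto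

lemma h_0_sym: "h u v = 0 \<Longrightarrow> h v u = 0"
  using h_sym[of v u] \<sigma>_0 by simp

text \<open>The trace map of the involution: \<open>Symd\<close> is its image, over \<open>D\<close>
  as well as over the ambient ring, and by \<open>h_Tr\<close> it produces the polar form of
  \<open>v \<mapsto> h v v\<close>.\<close>

definition Tr :: "'e \<Rightarrow> 'e" where
  "Tr x = x + lam * \<sigma> x"

lemma h_Tr: "h u v + h v u = Tr (h u v)"
  unfolding Tr_def using h_sym[of v u] by simp

lemma Tr_add: "Tr (x + y) = Tr x + Tr y"
  unfolding Tr_def by (simp add: \<sigma>_add algebra_simps)

lemma Tr_D: "d \<in> D \<Longrightarrow> Tr d \<in> Symd lam D \<theta>"
  unfolding Tr_def Symd_def using \<sigma>_D by auto

lemma Symd_D: "Symd lam D \<theta> = Tr ` D"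
  unfolding Tr_def Symd_def using \<sigma>_D by auto

lemma Symd_E: "Symd lam UNIV \<sigma> = range Tr"
  unfolding Tr_def Symd_def by auto

lemma Symd_D_subset: "Symd lam D \<theta> \<subseteq> D"
  unfolding Symd_def using D_add D_mult lam_D \<theta>_D by auto

lemma Tr_decomp: "d \<in> D \<Longrightarrow> d' \<in> D \<Longrightarrow> Tr (d + d' * \<alpha>) = Tr d + Tr d' * \<alpha>"
  unfolding Tr_def by (simp add: \<sigma>_decomp \<sigma>_D algebra_simps)

text \<open>\<open>is_theta_K\<close> prescribes \<sigma> only on products of an element of
  \<open>D\<close> with one of \<open>K\<close>. The general case follows by decomposing
  \<open>x\<close> along 1 and \<alpha> and moving the central \<open>k\<close> to the
  right.\<close>

lemma \<sigma>_mult_K: "k \<in> K \<Longrightarrow> \<sigma> (k * x) = k * \<sigma> x"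
proof -
  assume k: "k \<in> K"
  obtain a b where x: "a \<in> D" "b \<in> D" "x = a + b * \<alpha>" by (rule E_decomp)
  have "k * x = a * k + b * (\<alpha> * k)"
    unfolding x distrib_left using K_comm[OF k] by (simp add: mult.assoc)
  then have "\<sigma> (k * x) = \<theta> a * k + \<theta> b * (\<alpha> * k)"
    using \<sigma>_add \<sigma>_mult x k KE.S_mult[OF \<alpha>_K k] by simp
  then show ?thesis unfolding x \<sigma>_decomp[OF x(1,2)] distrib_left
    using K_comm[OF k] by (simp add: mult.assoc)
qed

lemma Tr_mult: "k \<in> K \<Longrightarrow> Tr (k * x) = k * Tr x"
  unfolding Tr_def \<sigma>_mult_K distrib_left using K_comm[OF lam_K] by (simp add: mult.assoc)

lemma Symd_D_subspace: "subspace_over (*) F (Symd lam D \<theta>)"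
  unfolding subspace_over_def
proof (intro conjI ballI)
  show "0 \<in> Symd lam D \<theta>" using Tr_D[OF D_0] unfolding Tr_def \<sigma>_0 by simp
next
  fix x y assume "x \<in> Symd lam D \<theta>" "y \<in> Symd lam D \<theta>"
  then show "x + y \<in> Symd lam D \<theta>" unfolding Symd_D by (auto simp: D_add simp flip: Tr_add)
next
  fix x f assume x: "x \<in> Symd lam D \<theta>" and f: "f \<in> F"
  then obtain d where d: "d \<in> D" "x = Tr d" unfolding Symd_D by auto
  have "x * f = Tr (f * d)" using Tr_mult[of f d] f FK K_comm[of f] d by auto
  then show "x * f \<in> Symd lam D \<theta>" using Tr_D[of "f * d"] d f FD D_mult by auto
qed

text \<open>With \<open>x = Tr a + Tr b * \<alpha>\<close> in \<open>D\<close>, comparing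
  \<alpha>-coordinates leaves \<open>x = Tr a\<close>.\<close>

lemma Symd_E_Int_D:
  assumes "x \<in> Symd lam UNIV \<sigma>" "x \<in> D"
  shows "x \<in> Symd lam D \<theta>"
proof -
  obtain y where y: "x = Tr y" using assms unfolding Symd_E by auto
  obtain a b where ab: "a \<in> D" "b \<in> D" "y = a + b * \<alpha>" by (rule E_decomp)
  have x: "x = Tr a + Tr b * \<alpha>" unfolding y ab Tr_decomp[OF ab(1,2)] ..
  have "Tr a \<in> D" "Tr b \<in> D" using Tr_D ab Symd_D_subset by blast+
  then have "x = Tr a" using decomp_unique[of x 0 "Tr a" "Tr b"] x D_0 assms by simp
  then show ?thesis using Tr_D ab by simp
qed

lemma h_self_Symd: "h v v \<in> Symd lam UNIV \<sigma>"
  using even unfolding herm_even_def by auto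

subsection \<open>Unimodular \<open>D\<close>-subspaces\<close>

lemma D_subspace_F: "subspace_over sm D P \<Longrightarrow> subspace_over sm F P"
  unfolding subspace_over_def using FD by auto

text \<open>For a \<open>D\<close>-subspace this is the span over \<open>K\<close>, the image of the
  scalar extension of \<open>P\<close>; by \<open>K_hull_act\<close> it contains all multiples of
  vectors of \<open>P\<close> by ambient scalars.\<close>

definition K_hull :: "'v set \<Rightarrow> 'v set" where
  "K_hull P = {p + sm p' \<alpha> | p p'. p \<in> P \<and> p' \<in> P}"

lemma K_hull_act:
  assumes P: "subspace_over sm D P" and "q \<in> P"
  shows "sm q e \<in> K_hull P"
proof -
  obtain a b where ab: "a \<in> D" "b \<in> D" "e = a + b * \<alpha>" by (rule E_decomp)
  then have "sm q e = sm q a + sm (sm q b) \<alpha>" by (simp add: sm_rules)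
  then show ?thesis unfolding K_hull_def using DV.sub_act[OF P] ab assms(2) by blast
qed

lemma K_hull_add:
  assumes P: "subspace_over sm D P" and x: "x \<in> K_hull P" and y: "y \<in> K_hull P"
  shows "x + y \<in> K_hull P"
proof -
  obtain a b c d where *: "x = a + sm b \<alpha>" "y = c + sm d \<alpha>" "a \<in> P" "b \<in> P" "c \<in> P" "d \<in> P"
    using x y unfolding K_hull_def by auto
  then have "x + y = (a + c) + sm (b + d) \<alpha>" by (simp add: sm_rules algebra_simps)
  then show ?thesis unfolding K_hull_def using DV.sub_add[OF P] * by blast
qed

lemma K_hull_mono: "P \<subseteq> Q \<Longrightarrow> K_hull P \<subseteq> K_hull Q"
  unfolding K_hull_def by blast

lemma orth_K_hull: "(\<And>p. p \<in> P \<Longrightarrow> h v p = 0) \<Longrightarrow> x \<in> K_hull P \<Longrightarrow> h v x = 0"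
  unfolding K_hull_def by (auto simp: h_add h_actr)

text \<open>The last clause says that the space is the sum of \<open>K_hull P\<close> and the
  orthogonal space of \<open>P\<close>. This splitting is carried along explicitly: projections give
  it for lines and hyperbolic planes, and it passes to orthogonal sums.\<close>

definition unimodular :: "'v set \<Rightarrow> bool" where
  "unimodular P \<longleftrightarrow> subspace_over sm D P \<and> (\<forall>p\<in>P. \<forall>q\<in>P. h p q \<in> D) \<and>
     (\<forall>p\<in>P. (\<forall>q\<in>P. h q p = 0) \<longrightarrow> p = 0) \<and>
     (\<forall>v. \<exists>x\<in>K_hull P. \<forall>q\<in>P. h q (v - x) = 0)"

lemma unimodular_0: "unimodular {0}"
  unfolding unimodular_def subspace_over_def K_hull_def
  using D_0 DV.act_zero_left KV.act_zero_left \<alpha>_K by (auto simp: h_0)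

text \<open>Orthogonality of \<open>P\<close> and \<open>Q\<close> extends to their hulls, so the
  projections of a vector to the two hulls add up to its projection to the hull of the sum.\<close>

lemma unimodular_plus:
  assumes P: "unimodular P" and Q: "unimodular Q"
    and PQ: "\<And>p q. p \<in> P \<Longrightarrow> q \<in> Q \<Longrightarrow> h p q = 0"
  shows "unimodular {p + q | p q. p \<in> P \<and> q \<in> Q}" (is "unimodular ?R")
proof -
  have QP: "h q p = 0" if "p \<in> P" "q \<in> Q" for p q using PQ that h_0_sym by blast
  have sP: "subspace_over sm D P" and sQ: "subspace_over sm D Q"
    using P Q unfolding unimodular_def by auto
  have PR: "P \<subseteq> ?R" and QR: "Q \<subseteq> ?R" using DV.sub_0[OF sP] DV.sub_0[OF sQ] by force+
  have sR: "subspace_over sm D ?R" using DV.subspace_plus[OF sP sQ] .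
  show ?thesis
    unfolding unimodular_def
  proof (intro conjI ballI allI impI)
    show "subspace_over sm D ?R" by (rule sR)
  next
    fix x y assume "x \<in> ?R" "y \<in> ?R"
    then obtain p q p' q' where "x = p + q" "y = p' + q'" "p \<in> P" "p' \<in> P" "q \<in> Q" "q' \<in> Q" by auto
    then show "h x y \<in> D" using P Q PQ QP D_add unfolding unimodular_def by (simp add: h_add)
  next
    fix x assume "x \<in> ?R" and x0: "\<forall>q\<in>?R. h q x = 0"
    then obtain p q where *: "x = p + q" "p \<in> P" "q \<in> Q" by auto
    have "h p' p = 0" if "p' \<in> P" for p'
      using x0[rule_format, of p'] PR that * PQ by (auto simp: h_add)
    moreover have "h q' q = 0" if "q' \<in> Q" for q'
      using x0[rule_format, of q'] QR that * QP by (auto simp: h_add)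
    ultimately have "p = 0" "q = 0" using P Q * unfolding unimodular_def by blast+
    then show "x = 0" using * by simp
  next
    fix v
    obtain x where x: "x \<in> K_hull P" "\<forall>q\<in>P. h q (v - x) = 0" using P unfolding unimodular_def by blast
    obtain y where y: "y \<in> K_hull Q" "\<forall>q\<in>Q. h q (v - y) = 0" using Q unfolding unimodular_def by blast
    have "x + y \<in> K_hull ?R"
      using K_hull_add[OF sR] K_hull_mono[OF PR] K_hull_mono[OF QR] x y by blast
    moreover have "h (p + q) (v - (x + y)) = 0" if "p \<in> P" "q \<in> Q" for p q
    proof -
      have "h p y = 0" using orth_K_hull[of Q p y] PQ that y by blast
      moreover have "h q x = 0" using orth_K_hull[of P q x] QP that x by blast
      ultimately show ?thesis using x(2) y(2) that by (auto simp: h_add h_diff)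
    qed
    ultimately show "\<exists>x\<in>K_hull ?R. \<forall>q\<in>?R. h q (v - x) = 0" by blast
  qed
qed

lemma unimodular_line:
  assumes u: "h u u \<in> D" "h u u \<noteq> 0"
  shows "unimodular {sm u d | d. d \<in> D}" (is "unimodular ?Q")
proof -
  have s: "subspace_over sm D ?Q"
    unfolding subspace_over_def
  proof (intro conjI ballI)
    show "0 \<in> ?Q" using D_0 EV.act_zero_right[of u] by force
  next
    fix x y assume "x \<in> ?Q" "y \<in> ?Q"
    then show "x + y \<in> ?Q" using D_add by (auto simp flip: sm_rules)
  next
    fix x a assume "x \<in> ?Q" "a \<in> D"
    then show "sm x a \<in> ?Q" using D_mult by (auto simp flip: sm_rules)
  qed
  show ?thesis
    unfolding unimodular_def
  proof (intro conjI ballI allI impI)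
    show "subspace_over sm D ?Q" by (rule s)
  next
    fix x y assume "x \<in> ?Q" "y \<in> ?Q"
    then show "h x y \<in> D" using u D_mult \<theta>_D by (auto simp: h_act \<sigma>_D)
  next
    fix x assume "x \<in> ?Q" and x0: "\<forall>q\<in>?Q. h q x = 0"
    then obtain d where d: "x = sm u d" "d \<in> D" by auto
    have "u \<in> ?Q" using D_1 sm_rules(4)[of u] by force
    then have "h u u * d = 0" using x0 d by (auto simp: h_actr)
    then show "x = 0" using u d EV.act_zero_right by auto
  next
    fix v
    \<comment> \<open>The orthogonal projection of \<open>v\<close> to the line; its coefficient
      lies in the ambient ring, not necessarily in \<open>D\<close>.\<close>
    let ?x = "sm u (inverse (h u u) * h u v)"
    have uQ: "u \<in> ?Q" using D_1 sm_rules(4)[of u] by force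
    have "h u (v - ?x) = 0" using u by (simp add: h_diff h_actr flip: mult.assoc)
    then have "\<forall>q\<in>?Q. h q (v - ?x) = 0" by (auto simp: h_actl)
    moreover have "?x \<in> K_hull ?Q" using K_hull_act[OF s uQ] .
    ultimately show "\<exists>x\<in>K_hull ?Q. \<forall>q\<in>?Q. h q (v - x) = 0" by blast
  qed
qed

lemma unimodular_plane:
  assumes u: "h u u = 0" and v: "h v v = 0" and uv: "h u v = 1"
  shows "unimodular {sm u d + sm v d' | d d'. d \<in> D \<and> d' \<in> D}" (is "unimodular ?Q")
proof -
  have vu: "h v u = lam" using h_sym[of v u] uv \<sigma>_K[OF KE.S_1] by simp
  have s: "subspace_over sm D ?Q"
    unfolding subspace_over_def
  proof (intro conjI ballI)
    have "0 = sm u 0 + sm v 0" using EV.act_zero_right by simp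
    then show "0 \<in> ?Q" using D_0 by blast
  next
    fix x y assume "x \<in> ?Q" "y \<in> ?Q"
    then obtain a b c d where *: "x = sm u a + sm v b" "y = sm u c + sm v d" "a \<in> D" "b \<in> D" "c \<in> D" "d \<in> D"
      by auto
    then have "x + y = sm u (a + c) + sm v (b + d)" by (simp add: sm_rules algebra_simps)
    then show "x + y \<in> ?Q" using D_add * by blast
  next
    fix x a assume "x \<in> ?Q" "a \<in> D"
    then obtain b c where *: "x = sm u b + sm v c" "b \<in> D" "c \<in> D" by auto
    then have "sm x a = sm u (b * a) + sm v (c * a)" by (simp add: sm_rules)
    then show "sm x a \<in> ?Q" using D_mult * \<open>a \<in> D\<close> by blast
  qed
  have "u = sm u 1 + sm v 0" "v = sm u 0 + sm v 1"
    using EV.act_zero_right sm_rules(4) by auto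
  then have uQ: "u \<in> ?Q" and vQ: "v \<in> ?Q" using D_0 D_1 by blast+
  show ?thesis
    unfolding unimodular_def
  proof (intro conjI ballI allI impI)
    show "subspace_over sm D ?Q" by (rule s)
  next
    fix x y assume "x \<in> ?Q" "y \<in> ?Q"
    then show "h x y \<in> D" using u v uv vu D_mult D_add D_0 \<theta>_D lam_D
      by (auto simp: h_add h_act \<sigma>_D)
  next
    fix x assume "x \<in> ?Q" and x0: "\<forall>q\<in>?Q. h q x = 0"
    then obtain d d' where d: "x = sm u d + sm v d'" by auto
    have "h u x = 0" "h v x = 0" using uQ vQ x0 by blast+
    then have "d' = 0" "lam * d = 0" using d u v uv vu by (auto simp: h_add h_actr)
    then show "x = 0" using lam d EV.act_zero_right by auto
  next
    fix w
    \<comment> \<open>Solves \<open>h u (w - ?x) = 0\<close> and \<open>h v (w - ?x) = 0\<close>,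
      using \<open>h v u = lam\<close> and \<open>lam * lam = 1\<close>.\<close>
    let ?x = "sm u (lam * h v w) + sm v (h u w)"
    have "h u (w - ?x) = 0" "h v (w - ?x) = 0"
      using u v uv vu lam_lam by (auto simp: h_diff h_add h_actr)
    then have "\<forall>q\<in>?Q. h q (w - ?x) = 0" by (auto simp: h_actl h_add(1))
    moreover have "?x \<in> K_hull ?Q" using K_hull_add[OF s] K_hull_act[OF s] uQ vQ by blast
    ultimately show "\<exists>x\<in>K_hull ?Q. \<forall>q\<in>?Q. h q (w - x) = 0" by blast
  qed
qed

text \<open>Evenness enters here: it lets a vector pairing to 1 with \<open>u\<close> be made isotropic.\<close>

lemma maximal_unimodular_anisotropic:
  assumes P: "unimodular P" and max: "\<And>Q. unimodular Q \<Longrightarrow> P \<subseteq> Q \<Longrightarrow> Q = P"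
    and orth: "\<And>p. p \<in> P \<Longrightarrow> h p u = 0" and u: "h u u \<in> D"
  shows "u = 0"
proof -
  have u_P: "u = 0" if "u \<in> P" using P orth that unfolding unimodular_def by blast
  \<comment> \<open>By maximality the orthogonal sum of \<open>P\<close> and \<open>Q\<close> is
    \<open>P\<close> again, so \<open>u\<close> lies in \<open>P\<close>, and it vanishes because
    \<open>h\<close> is regular on \<open>P\<close>.\<close>
  have extend: "u = 0" if Q: "unimodular Q" "u \<in> Q" "\<And>p q. p \<in> P \<Longrightarrow> q \<in> Q \<Longrightarrow> h p q = 0" for Q
  proof -
    let ?R = "{p + q | p q. p \<in> P \<and> q \<in> Q}"
    have "0 \<in> Q" "0 \<in> P" using Q P DV.sub_0 unfolding unimodular_def by auto
    then have "P \<subseteq> ?R" "u \<in> ?R" using Q(2) by force+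
    then show ?thesis using max[OF unimodular_plus[OF P Q(1,3)]] u_P by blast
  qed
  show ?thesis
  proof (cases "h u u = 0")
    case False
    have "u \<in> {sm u d | d. d \<in> D}" using D_1 sm_rules(4)[of u] by force
    then show ?thesis
      by (rule extend[OF unimodular_line[OF u False]]) (auto simp: h_actr orth)
  next
    case True
    show ?thesis
    proof (rule ccontr)
      assume "u \<noteq> 0"
      then obtain w0 where w0: "h u w0 \<noteq> 0" using reg unfolding herm_regular_def by auto
      define w where "w = sm w0 (inverse (h u w0))"
      have w: "h u w = 1" unfolding w_def using w0 by (simp add: h_actr)
      obtain x where x: "x \<in> K_hull P" "\<forall>q\<in>P. h q (w - x) = 0"
        using P unfolding unimodular_def by blast
      \<comment> \<open>Removing the projection makes the vector orthogonal to \<open>P\<close>; the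
        pairing with \<open>u\<close> stays 1 because \<open>u\<close> is orthogonal to the hull of
        \<open>P\<close>.\<close>
      define w1 where "w1 = w - x"
      have "h u x = 0" using orth_K_hull[of P u x] x orth h_0_sym by blast
      then have w1: "h u w1 = 1" "\<And>q. q \<in> P \<Longrightarrow> h q w1 = 0"
        unfolding w1_def using x w by (auto simp: h_diff)
      have w1u: "h w1 u = lam" using h_sym[of w1 u] w1 \<sigma>_K[OF KE.S_1] by simp
      obtain y where y: "h w1 w1 = y + lam * \<sigma> y"
        using h_self_Symd[of w1] unfolding Symd_def by auto
      \<comment> \<open>Since \<open>u\<close> is isotropic, the correction changes
        \<open>h w1 w1\<close> by \<open>- y - lam * \<sigma> y\<close> only, which cancels
        it.\<close>
      define w2 where "w2 = w1 - sm u (lam * y)"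
      have "h w2 w2 = 0"
        unfolding w2_def using y w1 w1u True lam_lam \<sigma>_mult_K[OF lam_K]
        by (simp add: h_diff h_actr h_actl)
      moreover have "h u w2 = 1" unfolding w2_def using w1 True by (simp add: h_diff h_actr)
      ultimately have Q: "unimodular {sm u d + sm w2 d' | d d'. d \<in> D \<and> d' \<in> D}" (is "unimodular ?Q")
        using unimodular_plane True by blast
      have "h p w2 = 0" if "p \<in> P" for p
        unfolding w2_def using w1 orth that by (simp add: h_diff h_actr)
      then have "h p q = 0" if "p \<in> P" "q \<in> ?Q" for p q
        using that orth by (auto simp: h_add h_actr)
      moreover have "u = sm u 1 + sm w2 0" using EV.act_zero_right sm_rules(4) by simp
      then have "u \<in> ?Q" using D_0 D_1 by blast
      ultimately show False using extend[OF Q] \<open>u \<noteq> 0\<close> by blast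
    qed
  qed
qed

section \<open>Maximal unimodular subspaces and descent from a unimodular subspace\<close>

lemma F_finitely_spanned: obtains X where "finite X" "lin_span sm F X = UNIV"
proof -
  obtain Y where Y: "finite Y" "lin_span (*) F Y = D" using D_fin by auto
  obtain X where X: "finite X" "lin_span sm UNIV X = UNIV"
    using herm unfolding herm_space_def by auto
  let ?Y = "Y \<union> (\<lambda>y. y * \<alpha>) ` Y"
  let ?Z = "(\<lambda>(x, y). sm x y) ` (X \<times> ?Y)"
  let ?A = "lin_span sm F ?Z"
  have x: "sm x e \<in> ?A" if x: "x \<in> X" for x e
  proof -
    \<comment> \<open>Used for \<open>k = 1\<close> and \<open>k = \<alpha>\<close>: it suffices to
      test the generators \<open>Y\<close> of \<open>D\<close>, and both halves of
      \<open>e = a + b * \<alpha>\<close> are covered.\<close>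
    have s: "subspace_over (*) F {e. sm x (e * k) \<in> ?A}" if k: "k \<in> K" for k
      unfolding subspace_over_def
    proof (intro conjI ballI)
      show "0 \<in> {e. sm x (e * k) \<in> ?A}"
        using FV.sub_0[OF FV.lin_span_subspace] EV.act_zero_right by simp
    next
      fix e e' assume "e \<in> {e. sm x (e * k) \<in> ?A}" "e' \<in> {e. sm x (e * k) \<in> ?A}"
      then show "e + e' \<in> {e. sm x (e * k) \<in> ?A}"
        using FV.sub_add[OF FV.lin_span_subspace, of "sm x (e * k)" ?Z "sm x (e' * k)"]
        by (simp add: distrib_right sm_rules(2))
    next
      fix e f assume e: "e \<in> {e. sm x (e * k) \<in> ?A}" and f: "f \<in> F"
      have "e * f * k = e * k * f" using K_comm[OF k, of f] by (simp add: mult.assoc)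
      then have "sm x (e * f * k) = sm (sm x (e * k)) f" by (simp only: sm_rules(3))
      then show "e * f \<in> {e. sm x (e * k) \<in> ?A}"
        using FV.sub_act[OF FV.lin_span_subspace, of "sm x (e * k)" ?Z f] e f by simp
    qed
    have s: "subspace_over (*) F {e. sm x e \<in> ?A}" "subspace_over (*) F {e. sm x (e * \<alpha>) \<in> ?A}"
      using s[OF KE.S_1] s[OF \<alpha>_K] by auto
    have "Y \<subseteq> {e. sm x e \<in> ?A}" "Y \<subseteq> {e. sm x (e * \<alpha>) \<in> ?A}"
      using FV.lin_span_superset[of ?Z] x by force+
    then have *: "D \<subseteq> {e. sm x e \<in> ?A}" "D \<subseteq> {e. sm x (e * \<alpha>) \<in> ?A}"
      using FE.lin_span_least[OF s(1), of Y] FE.lin_span_least[OF s(2), of Y] Y(2) by simp_all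
    obtain a b where "a \<in> D" "b \<in> D" "e = a + b * \<alpha>" by (rule E_decomp)
    moreover have "sm x a \<in> ?A" "sm x (b * \<alpha>) \<in> ?A" using * calculation by blast+
    ultimately show ?thesis using FV.sub_add[OF FV.lin_span_subspace] sm_rules(2) by metis
  qed
  have "v \<in> ?A" for v
  proof -
    have "v \<in> lin_span sm UNIV X" using X by simp
    then obtain n w c where "v = (\<Sum>i<n::nat. sm (w i) (c i))" "\<forall>i<n. w i \<in> X"
      unfolding lin_span_def by auto
    then show ?thesis using x by (auto intro!: FV.sub_sum[OF FV.lin_span_subspace])
  qed
  then show thesis using that[of ?Z] X Y by auto
qed

lemma maximal_unimodular_exists:
  obtains P where "unimodular P" "\<And>Q. unimodular Q \<Longrightarrow> P \<subseteq> Q \<Longrightarrow> Q = P"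
proof -
  obtain X where X: "finite X" "lin_span sm F X = UNIV" by (rule F_finitely_spanned)
  have "subspace_over sm F P" if "unimodular P" for P
    using that D_subspace_F unfolding unimodular_def by auto
  then show thesis
    using FV.maximal_subspace_exists[OF X, of unimodular "{0}"] unimodular_0 that by blast
qed

text \<open>Both \<open>h q p\<close> and \<open>h q p * \<alpha>\<close> lie in \<open>D\<close>,
  which forces \<open>h q p = 0\<close>; then \<open>h\<close> being regular on \<open>P\<close>
  applies. This expresses that \<open>P\<close> and its \<alpha>-multiple are independent.\<close>

lemma D_valued_\<alpha>_eq_0:
  assumes P: "unimodular P" and p: "p \<in> P" and D: "\<And>q. q \<in> P \<Longrightarrow> h q (sm p \<alpha>) \<in> D"
  shows "p = 0"
proof -
  have "h q p = 0" if q: "q \<in> P" for q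
  proof -
    have qp: "h q p \<in> D" using P p q unfolding unimodular_def by blast
    have "im (h q p * \<alpha>) = 0" using D[OF q] im_D by (simp add: h_actr)
    then show ?thesis using im_D_\<alpha>[OF qp] K_comm[OF \<alpha>_K, of "h q p"] by simp
  qed
  then show ?thesis using P p unfolding unimodular_def by blast
qed

lemma herm_descent_if_unimodular:
  assumes P: "unimodular P" and hullP: "K_hull P = UNIV"
  shows "herm_descent F K D \<theta> lam UNIV sm h"
proof -
  have sD: "subspace_over sm D P" and hD: "\<And>p q. p \<in> P \<Longrightarrow> q \<in> P \<Longrightarrow> h p q \<in> D"
    using P unfolding unimodular_def by auto
  have sF: "subspace_over sm F P" using sD by (rule D_subspace_F)
  obtain X where X: "finite X" "lin_span sm F X = UNIV" by (rule F_finitely_spanned)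
  obtain Y where Y: "finite Y" "Y \<subseteq> P" "lin_span sm F Y = P"
    using FV.subspace_finitely_spanned[OF X(1) sF] X(2) by auto
  have "subspace_over sm F (lin_span sm D Y)"
    by (rule D_subspace_F[OF DV.lin_span_subspace])
  then have "P \<subseteq> lin_span sm D Y"
    using FV.lin_span_least DV.lin_span_superset[of Y] Y by blast
  then have "lin_span sm D Y = P" using DV.lin_span_least[OF sD Y(2)] by blast
  then have fin: "\<exists>X. finite X \<and> X \<subseteq> P \<and> lin_span sm D X = P" using Y by blast
  have "herm_space D \<theta> lam P sm h"
    unfolding herm_space_def
  proof (intro conjI ballI)
    fix u v assume "u \<in> P" "v \<in> P"
    then show "h v u = lam * \<theta> (h u v)" using h_sym[of v u] hD \<sigma>_D by simp
  qed (use sD hD fin in \<open>auto simp: sm_rules h_add h_act \<sigma>_D\<close>)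
  moreover have "lin_span sm K P = UNIV"
    using lin_span_K[OF KV.scalars_axioms FV.scalars_axioms sF] hullP unfolding K_hull_def by simp
  moreover have "lin_indep sm K X" if X: "X \<subseteq> P" "lin_indep sm F X" for X
    unfolding lin_indep_def
  proof (intro allI impI, elim conjE)
    fix n :: nat and w c i
    assume wc: "\<forall>i<n. w i \<in> X \<and> c i \<in> K" and inj: "inj_on w {..<n}"
      and s0: "(\<Sum>i<n. sm (w i) (c i)) = 0" and i: "i < n"
    have "\<forall>i. \<exists>f g. i < n \<longrightarrow> f \<in> F \<and> g \<in> F \<and> c i = f + g * \<alpha>"
      using wc K_decomp by metis
    then obtain f g where fg: "\<And>i. i < n \<Longrightarrow> f i \<in> F \<and> g i \<in> F \<and> c i = f i + g i * \<alpha>" by metis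
    \<comment> \<open>Splitting the coefficients along 1 and \<alpha> turns the
      \<open>K\<close>-relation into \<open>p + sm p' \<alpha> = 0\<close>. Both parts vanish, which
      leaves two relations over \<open>F\<close>.\<close>
    define p where "p = (\<Sum>i<n. sm (w i) (f i))"
    define p' where "p' = (\<Sum>i<n. sm (w i) (g i))"
    have pP: "p \<in> P" "p' \<in> P"
      unfolding p_def p'_def using wc X(1) fg
      by (auto intro!: FV.sub_sum[OF sF] FV.sub_act[OF sF])
    have "(\<Sum>i<n. sm (w i) (c i)) = (\<Sum>i<n. sm (w i) (f i) + sm (sm (w i) (g i)) \<alpha>)"
      using fg by (intro sum.cong) (auto simp: sm_rules)
    then have e: "p + sm p' \<alpha> = 0"
      unfolding p_def p'_def using s0 by (simp add: sum.distrib EV.act_sum)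
    then have "sm p' \<alpha> = - p" by (simp add: eq_neg_iff_add_eq_0 add.commute)
    then have p': "p' = 0"
      using D_valued_\<alpha>_eq_0[OF P pP(2)] hD pP DV.sub_minus[OF sD] by simp
    then have "p = 0" using e EV.act_zero_left by simp
    then have "f i = 0" "g i = 0"
      using X(2)[unfolded lin_indep_def, rule_format, of n w f i]
        X(2)[unfolded lin_indep_def, rule_format, of n w g i] wc fg inj i p' p_def p'_def by auto
    then show "c i = 0" using fg[OF i] by simp
  qed
  ultimately show ?thesis unfolding herm_descent_def scalar_ext_iso_def by blast
qed

end

section \<open>The system of quadratic forms and its transfer\<close>

locale quadratic_herm_basis = quadratic_herm +
  fixes B :: "nat \<Rightarrow> 'a" and m :: nat
  assumes basis: "is_basis_list F (Symd lam D \<theta>) B m"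
begin

section \<open>Coordinates on \<open>Symd\<close> over \<open>F\<close> and over
  \<open>K\<close>\<close>

lemma B_Symd: "j < m \<Longrightarrow> B j \<in> Symd lam D \<theta>"
  using basis unfolding is_basis_list_def by auto

lemma B_D: "j < m \<Longrightarrow> B j \<in> D"
  using B_Symd Symd_D_subset by auto

lemma B_independent:
  assumes "\<And>j. j < m \<Longrightarrow> c j \<in> K" "(\<Sum>j<m. c j * B j) = 0" "i < m"
  shows "c i = 0"
proof -
  have "B ` {..<m} \<subseteq> D" using B_D by auto
  then have "lin_indep (*) K (B ` {..<m})"
    using DK basis unfolding scalar_ext_iso_def is_basis_list_def by blast
  moreover have "(\<Sum>j<m. B j * c j) = (\<Sum>j<m. c j * B j)"
    using assms(1) K_comm by (intro sum.cong) auto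
  then have "(\<Sum>j<m. B j * c j) = 0" using assms(2) by simp
  moreover have "inj_on B {..<m}" using basis unfolding is_basis_list_def by auto
  ultimately show ?thesis
    using assms(1,3) unfolding lin_indep_def by blast
qed

text \<open>The dual basis as functions of an element of \<open>Symd\<close>, so that it applies to
  polar values \<open>Tr (h u v)\<close> and not only to \<open>h v v\<close>.\<close>

definition crd :: "'a \<Rightarrow> nat \<Rightarrow> 'a" where
  "crd x = (THE c. (\<forall>j<m. c j \<in> K) \<and> (\<forall>j. m \<le> j \<longrightarrow> c j = 0) \<and> x = (\<Sum>j<m. c j * B j))"

lemma q_form_crd: "q_form K h B m v = crd (h v v)"
  unfolding q_form_def crd_def ..

lemma crd_eq:
  assumes "\<And>j. j < m \<Longrightarrow> c j \<in> K" "\<And>j. m \<le> j \<Longrightarrow> c j = 0"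
  shows "crd (\<Sum>j<m. c j * B j) = c"
  unfolding crd_def
proof (rule the_equality)
  fix c' assume c': "(\<forall>j<m. c' j \<in> K) \<and> (\<forall>j. m \<le> j \<longrightarrow> c' j = 0) \<and>
    (\<Sum>j<m. c j * B j) = (\<Sum>j<m. c' j * B j)"
  have "c' j - c j = 0" if "j < m" for j
  proof (rule B_independent[OF _ _ that])
    show "(\<Sum>j<m. (c' j - c j) * B j) = 0"
      using c' by (simp add: left_diff_distrib sum_subtractf)
    show "c' j - c j \<in> K" if "j < m" for j
      using KE.S_add[of "c' j" "- c j"] KE.S_minus[of "c j"] c' assms(1) that by simp
  qed
  then show "c' = c" using c' assms(2) by (metis eq_iff_diff_eq_0 ext not_le)
qed (use assms in auto)

text \<open>Passes from spans by arbitrary sequences to one coefficient per basis element: the sums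
  of the latter shape form an \<open>F\<close>-subspace containing \<open>B\<close>.\<close>

lemma Symd_D_coords:
  assumes "x \<in> Symd lam D \<theta>"
  obtains c where "\<And>j. c j \<in> F" "\<And>j. m \<le> j \<Longrightarrow> c j = 0" "x = (\<Sum>j<m. c j * B j)"
proof -
  let ?A = "{x. \<exists>c. (\<forall>j. c j \<in> F) \<and> (\<forall>j. m \<le> j \<longrightarrow> c j = 0) \<and> x = (\<Sum>j<m. c j * B j)}"
  have "subspace_over (*) F ?A"
    unfolding subspace_over_def
  proof (intro conjI ballI)
    show "0 \<in> ?A" using FE.S_0 by (auto intro!: exI[of _ "\<lambda>_. 0"])
  next
    fix x y assume "x \<in> ?A" "y \<in> ?A"
    then obtain c d where "\<forall>j. c j \<in> F" "\<forall>j. m \<le> j \<longrightarrow> c j = 0" "x = (\<Sum>j<m. c j * B j)"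
      "\<forall>j. d j \<in> F" "\<forall>j. m \<le> j \<longrightarrow> d j = 0" "y = (\<Sum>j<m. d j * B j)" by auto
    then show "x + y \<in> ?A"
      using FE.S_add by (auto intro!: exI[of _ "\<lambda>j. c j + d j"] simp: distrib_right sum.distrib)
  next
    fix x f assume "x \<in> ?A" and f: "f \<in> F"
    then obtain c where c: "\<forall>j. c j \<in> F" "\<forall>j. m \<le> j \<longrightarrow> c j = 0" "x = (\<Sum>j<m. c j * B j)" by auto
    then have "x * f = f * x" using K_comm[of f x] f FK by auto
    also have "\<dots> = (\<Sum>j<m. (f * c j) * B j)" using c by (simp add: sum_distrib_left mult.assoc)
    finally show "x * f \<in> ?A"
      using c f FE.S_mult by (auto intro!: exI[of _ "\<lambda>j. f * c j"])
  qed
  moreover have "B ` {..<m} \<subseteq> ?A"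
  proof (rule image_subsetI)
    fix k assume k: "k \<in> {..<m}"
    have "B k = (\<Sum>j<m. (if j = k then 1 else 0) * B j)"
      using k by (simp add: if_distrib[of "\<lambda>z. z * _"] cong: if_cong)
    then show "B k \<in> ?A"
      using k FE.S_0 FE.S_1 by (auto intro!: exI[of _ "\<lambda>j. if j = k then 1 else 0"])
  qed
  ultimately have "Symd lam D \<theta> \<subseteq> ?A"
    using FE.lin_span_least[of ?A "B ` {..<m}"] basis unfolding is_basis_list_def by auto
  then show thesis using assms that by blast
qed

lemma crd_F: "x \<in> Symd lam D \<theta> \<Longrightarrow> crd x j \<in> F"
  by (erule Symd_D_coords) (use crd_eq FK in \<open>metis subsetD\<close>)

lemma Symd_E_coords:
  assumes "x \<in> Symd lam UNIV \<sigma>"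
  obtains c where "\<And>j. c j \<in> K" "\<And>j. m \<le> j \<Longrightarrow> c j = 0" "x = (\<Sum>j<m. c j * B j)"
proof -
  obtain y where y: "x = Tr y" using assms unfolding Symd_E by auto
  obtain a b where ab: "a \<in> D" "b \<in> D" "y = a + b * \<alpha>" by (rule E_decomp)
  obtain c where c: "\<And>j. c j \<in> F" "\<And>j. m \<le> j \<Longrightarrow> c j = 0" "Tr a = (\<Sum>j<m. c j * B j)"
    using Symd_D_coords[OF Tr_D[OF ab(1)]] by blast
  obtain d where d: "\<And>j. d j \<in> F" "\<And>j. m \<le> j \<Longrightarrow> d j = 0" "Tr b = (\<Sum>j<m. d j * B j)"
    using Symd_D_coords[OF Tr_D[OF ab(2)]] by blast
  have "x = Tr a + \<alpha> * Tr b" unfolding y ab Tr_decomp[OF ab(1,2)] using K_comm[OF \<alpha>_K] by simp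
  also have "\<dots> = (\<Sum>j<m. (c j + \<alpha> * d j) * B j)"
    unfolding c d by (simp add: sum_distrib_left sum.distrib distrib_right mult.assoc)
  finally show thesis
    using that[of "\<lambda>j. c j + \<alpha> * d j"] c d FK KE.S_add KE.S_mult \<alpha>_K by (simp add: subsetD)
qed

lemma crd_K: "x \<in> Symd lam UNIV \<sigma> \<Longrightarrow> crd x j \<in> K"
  and crd_beyond: "x \<in> Symd lam UNIV \<sigma> \<Longrightarrow> m \<le> j \<Longrightarrow> crd x j = 0"
  and crd_sum: "x \<in> Symd lam UNIV \<sigma> \<Longrightarrow> x = (\<Sum>j<m. crd x j * B j)"
  by (erule Symd_E_coords, metis crd_eq)+

lemma crd_add:
  assumes "x \<in> Symd lam UNIV \<sigma>" "y \<in> Symd lam UNIV \<sigma>"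
  shows "crd (x + y) j = crd x j + crd y j"
proof -
  have "x + y = (\<Sum>j<m. (crd x j + crd y j) * B j)"
    unfolding distrib_right sum.distrib using crd_sum assms by simp
  then have "crd (x + y) = (\<lambda>j. crd x j + crd y j)"
    using crd_eq[of "\<lambda>j. crd x j + crd y j"] crd_K crd_beyond assms KE.S_add by simp
  then show ?thesis by simp
qed

lemma crd_mult:
  assumes "x \<in> Symd lam UNIV \<sigma>" "k \<in> K"
  shows "crd (k * x) j = k * crd x j"
proof -
  have "k * x = (\<Sum>j<m. (k * crd x j) * B j)"
    unfolding mult.assoc sum_distrib_left[symmetric] using crd_sum assms by simp
  then have "crd (k * x) = (\<lambda>j. k * crd x j)"
    using crd_eq[of "\<lambda>j. k * crd x j"] crd_K crd_beyond assms KE.S_mult by simp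
  then show ?thesis by simp
qed

section \<open>From a descent of \<open>h\<close> to a descent of the quadratic system\<close>

lemma Tr_Symd_E: "Tr x \<in> Symd lam UNIV \<sigma>"
  unfolding Symd_E by simp

lemma q_form_add: "q_form K h B m (u + v) j = q_form K h B m u j + q_form K h B m v j + crd (Tr (h u v)) j"
proof -
  have "h (u + v) (u + v) = h u u + h v v + (h u v + h v u)"
    by (simp add: h_add algebra_simps)
  moreover have "h u u + h v v \<in> Symd lam UNIV \<sigma>"
    using h_self_Symd[of u] h_self_Symd[of v] unfolding Symd_E by (auto simp flip: Tr_add)
  ultimately have "crd (h (u + v) (u + v)) j = crd (h u u + h v v) j + crd (Tr (h u v)) j"
    using crd_add[OF _ Tr_Symd_E] h_Tr[of u v] by simp
  then show ?thesis unfolding q_form_crd using crd_add[OF h_self_Symd h_self_Symd] by simp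
qed

text \<open>The same \<open>W\<close> works for both. On it \<open>h w w\<close> lies in
  \<open>D\<close> and in \<open>Symd\<close> of the ambient ring, hence in \<open>Symd\<close> of
  \<open>D\<close>, so its coordinates are in \<open>F\<close>.\<close>

lemma quad_descent_if_herm_descent:
  assumes "herm_descent F K D \<theta> lam UNIV sm h"
  shows "quad_descent sm F K UNIV m (q_form K h B m)"
proof -
  obtain W where W: "herm_space D \<theta> lam W sm h" "scalar_ext_iso sm F K W UNIV"
    using assms unfolding herm_descent_def by auto
  have sD: "subspace_over sm D W" and hD: "\<And>u v. u \<in> W \<Longrightarrow> v \<in> W \<Longrightarrow> h u v \<in> D"
    using W(1) unfolding herm_space_def by blast+
  have "quad_map sm F W m (q_form K h B m)"
    unfolding quad_map_def Let_def q_form_add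
  proof (intro conjI ballI allI impI)
    fix v i assume "v \<in> W"
    then show "q_form K h B m v i \<in> F"
      unfolding q_form_crd using crd_F Symd_E_Int_D h_self_Symd hD by blast
  next
    fix v a i assume "v \<in> W" and a: "a \<in> F"
    then have a: "a \<in> K" using FK by auto
    have "h (sm v a) (sm v a) = a * (h v v * a)" by (simp add: h_act \<sigma>_K[OF a] mult.assoc)
    also have "h v v * a = a * h v v" by (rule K_comm[OF a, symmetric])
    finally have "h (sm v a) (sm v a) = (a * a) * h v v" by (simp add: mult.assoc)
    then show "q_form K h B m (sm v a) i = a * a * q_form K h B m v i"
      unfolding q_form_crd using crd_mult[OF h_self_Symd KE.S_mult[OF a a]] by simp
  next
    fix u v a i assume a: "a \<in> F"
    then have a: "a \<in> K" using FK by auto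
    have "Tr (h (sm u a) v) = a * Tr (h u v)" using Tr_mult[OF a] by (simp add: h_actl \<sigma>_K[OF a])
    then show "q_form K h B m (sm u a) i + q_form K h B m v i + crd (Tr (h (sm u a) v)) i -
        q_form K h B m (sm u a) i - q_form K h B m v i =
      a * (q_form K h B m u i + q_form K h B m v i + crd (Tr (h u v)) i -
        q_form K h B m u i - q_form K h B m v i)"
      using crd_mult[OF Tr_Symd_E a] by simp
  qed (auto simp: q_form_crd crd_beyond h_self_Symd h_add Tr_add crd_add Tr_Symd_E)
  then show ?thesis
    unfolding quad_descent_def using W(2) D_subspace_F[OF sD] by blast
qed

text \<open>The transfer of the first coordinate of the polar form along \<open>im\<close>, whose kernel in
  \<open>K\<close> is \<open>F\<close>.\<close>

definition bil :: "'b \<Rightarrow> 'b \<Rightarrow> 'a" where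
  "bil u v = im (crd (Tr (h u v)) 0)"

section \<open>Orthogonality for the transferred form \<open>bil\<close>\<close>

lemma Tr_h_sym: "Tr (h u v) = Tr (h v u)"
  using h_Tr[of u v] h_Tr[of v u] by (simp add: add.commute)

lemma bil_sym: "bil u v = bil v u"
  unfolding bil_def using Tr_h_sym[of u v] by simp

lemma bil_F: "bil u v \<in> F"
  unfolding bil_def using im_K crd_K Tr_Symd_E by blast

lemma bil_add: "bil (u + u') v = bil u v + bil u' v" "bil v (u + u') = bil v u + bil v u'"
  unfolding bil_def by (simp_all add: h_add Tr_add crd_add Tr_Symd_E im_add)

lemma bil_act: "c \<in> F \<Longrightarrow> bil (sm u c) v = c * bil u v" "c \<in> F \<Longrightarrow> bil v (sm u c) = c * bil v u"
proof -
  have *: "bil (sm u c) v = c * bil u v" if c: "c \<in> F" for u v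
  proof -
    have c': "c \<in> K" "c \<in> D" using c FK FD by auto
    show ?thesis unfolding bil_def
      using Tr_mult[OF c'(1), of "h u v"] crd_mult[OF Tr_Symd_E c'(1)] im_mult[OF c'(2)]
      by (simp add: h_actl \<sigma>_K[OF c'(1)])
  qed
  show "c \<in> F \<Longrightarrow> bil (sm u c) v = c * bil u v" by (rule *)
  show "c \<in> F \<Longrightarrow> bil v (sm u c) = c * bil v u" using *[of u v] bil_sym by simp
qed

lemma bil_0: "bil 0 v = 0" "bil v 0 = 0"
  using bil_add(1)[of 0 0 v] bil_add(2)[of v 0 0] by auto

lemma bil_D_eq_0: "h u v \<in> D \<Longrightarrow> bil u v = 0"
  unfolding bil_def using im_D FD crd_F Tr_D by blast

text \<open>Multiplication by \<alpha> moves a coordinate in \<open>F\<close> to where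
  \<open>im\<close> reads it off, so \<open>bil\<close> recovers the coordinate itself.\<close>

lemma bil_act_\<alpha>:
  assumes "crd (Tr (h u v)) 0 \<in> F"
  shows "bil (sm u \<alpha>) v = crd (Tr (h u v)) 0"
  unfolding bil_def using Tr_mult[OF \<alpha>_K, of "h u v"] crd_mult[OF Tr_Symd_E \<alpha>_K] im_D_\<alpha> FD assms
  by (auto simp: h_actl \<sigma>_K[OF \<alpha>_K])

text \<open>One coordinate detects the whole \<alpha>-part \<open>b\<close> of \<open>h u v\<close>,
  because \<open>U\<close> is stable under \<open>D\<close>: if \<open>b\<close> is nonzero,
  replacing \<open>u\<close> by a \<open>D\<close>-multiple turns \<open>b\<close> into an element
  with trace \<open>B 0\<close>, whose first coordinate is 1.\<close>

lemma bil_orth_D: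
  assumes m: "0 < m" and U: "subspace_over sm D U" and orth: "\<And>u. u \<in> U \<Longrightarrow> bil u v = 0"
    and u: "u \<in> U"
  shows "h u v \<in> D"
proof -
  obtain a b where ab: "a \<in> D" "b \<in> D" "h u v = a + b * \<alpha>" by (rule E_decomp)
  have "b = 0"
  proof (rule ccontr)
    assume b: "b \<noteq> 0"
    obtain z where z: "z \<in> D" "B 0 = Tr z" using B_Symd[OF m] unfolding Symd_D by auto
    \<comment> \<open>Chosen so that \<open>\<theta> d * b = z\<close>, as \<sigma> moves
      \<open>d\<close> to the left of \<open>h u v\<close>.\<close>
    define d where "d = \<theta> (z * inverse b)"
    have zb: "z * inverse b \<in> D" using z ab D_mult D_inverse by auto
    then have d: "d \<in> D" "\<theta> d = z * inverse b" unfolding d_def using \<theta>_D \<theta>_\<theta> by auto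
    have "h (sm u d) v = \<theta> d * a + z * \<alpha>"
      using b d \<sigma>_D[OF d(1)] by (simp add: h_actl ab distrib_left mult.assoc flip: mult.assoc[of "inverse b" b])
    then have T: "Tr (h (sm u d) v) = Tr (\<theta> d * a) + \<alpha> * B 0"
      using Tr_decomp[OF D_mult[OF \<theta>_D[OF d(1)] ab(1)] z(1)] z(2) K_comm[OF \<alpha>_K, of "B 0"]
      by simp
    let ?e = "\<lambda>j. if j = 0 then 1 else 0 :: 'a"
    have "(\<Sum>j<m. ?e j * B j) = B 0" using m by (simp add: if_distrib[of "\<lambda>z. z * _"] cong: if_cong)
    then have "crd (B 0) = ?e" using crd_eq[of ?e] m KE.S_0 KE.S_1 by auto
    moreover have B: "B 0 \<in> Symd lam UNIV \<sigma>" unfolding z Symd_E by simp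
    moreover have "\<alpha> * B 0 \<in> Symd lam UNIV \<sigma>" unfolding z Symd_E by (simp flip: Tr_mult[OF \<alpha>_K])
    ultimately have "crd (Tr (h (sm u d) v)) 0 = crd (Tr (\<theta> d * a)) 0 + \<alpha> * 1"
      unfolding T using crd_add[OF Tr_Symd_E] crd_mult[OF _ \<alpha>_K] by simp
    \<comment> \<open>The contribution of the \<open>D\<close>-part has its coordinate in
      \<open>F\<close>, so \<open>im\<close> kills it.\<close>
    moreover have "crd (Tr (\<theta> d * a)) 0 \<in> D"
      using crd_F[OF Tr_D] D_mult \<theta>_D d ab FD by blast
    ultimately have "bil (sm u d) v = 1"
      unfolding bil_def using im_add im_D im_D_\<alpha>[OF D_1] by simp
    then show False using orth[OF DV.sub_act[OF U u d(1)]] by simp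
  qed
  then show ?thesis using ab by simp
qed

text \<open>Applied to the whole space, \<open>bil_orth_D\<close> puts every \<open>h u v\<close> in
  \<open>D\<close>; scaling \<open>u\<close> by \<alpha> puts the \<alpha>-multiple there too, so
  \<open>h u v = 0\<close>.\<close>

lemma bil_nondegenerate:
  assumes m: "0 < m" and v: "\<And>u. bil u v = 0"
  shows "v = 0"
proof -
  have D: "h u v \<in> D" for u using bil_orth_D[OF m DV.subspace_UNIV v] by simp
  have "h u v = 0" for u
  proof -
    have "im (\<alpha> * h u v) = 0" using im_D[OF D[of "sm u \<alpha>"]] by (simp add: h_actl \<sigma>_K[OF \<alpha>_K])
    then show ?thesis using im_D_\<alpha>[OF D] by simp
  qed
  then show ?thesis using h_0_sym reg unfolding herm_regular_def by blast
qed

lemma bil_double_orthogonal: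
  assumes m: "0 < m" and A: "subspace_over sm F A"
    and v: "\<And>x. (\<And>a. a \<in> A \<Longrightarrow> bil x a = 0) \<Longrightarrow> bil x v = 0"
  shows "v \<in> A"
proof -
  obtain X where X: "finite X" "lin_span sm F X = UNIV" by (rule F_finitely_spanned)
  obtain Y where Y: "finite Y" "lin_span sm F Y = A"
    using FV.subspace_finitely_spanned[OF X(1) A] X(2) by auto
  show ?thesis
    using FV.double_orthogonal[OF Y(1) F_central, of bil v] bil_F bil_add bil_act
      bil_nondegenerate[OF m] v Y(2) by simp
qed

text \<open>Together the conclusions say that \<open>W\<close> is its own orthogonal space. Polar
  values on \<open>W\<close> lie in \<open>F\<close>, where \<open>im\<close> vanishes; conversely,
  the \<alpha>-part of a vector orthogonal to \<open>W\<close> turns out to be in the radical of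
  \<open>bil\<close>.\<close>

lemma bil_quad_descent:
  assumes m: "0 < m" and W: "scalar_ext_iso sm F K W UNIV" "subspace_over sm F W"
    and q: "\<And>w. w \<in> W \<Longrightarrow> q_form K h B m w 0 \<in> F"
  shows "w \<in> W \<Longrightarrow> w' \<in> W \<Longrightarrow> bil w w' = 0"
    and "(\<And>w. w \<in> W \<Longrightarrow> bil v w = 0) \<Longrightarrow> v \<in> W"
proof -
  have F: "crd (Tr (h w w')) 0 \<in> F" if "w \<in> W" "w' \<in> W" for w w'
  proof -
    have e: "crd (Tr (h w w')) 0 = q_form K h B m (w + w') 0 + - q_form K h B m w 0 + - q_form K h B m w' 0"
      unfolding q_form_add by simp
    show ?thesis
      unfolding e by (intro FE.S_add FE.S_minus q FV.sub_add[OF W(2)] that)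
  qed
  show iso: "bil w w' = 0" if "w \<in> W" "w' \<in> W" for w w'
    unfolding bil_def using F[OF that] FD im_D by blast
  have decomp: "\<exists>w1\<in>W. \<exists>w2\<in>W. v = w1 + sm w2 \<alpha>" for v
  proof -
    have "v \<in> lin_span sm K W" using W(1) unfolding scalar_ext_iso_def by simp
    then show ?thesis
      unfolding lin_span_K[OF KV.scalars_axioms FV.scalars_axioms W(2)] by auto
  qed
  show "v \<in> W" if v: "\<And>w. w \<in> W \<Longrightarrow> bil v w = 0"
  proof -
    obtain w1 w2 where w: "w1 \<in> W" "w2 \<in> W" "v = w1 + sm w2 \<alpha>" using decomp by blast
    \<comment> \<open>Against \<open>w\<close> in \<open>W\<close> the part \<open>w1\<close>
      contributes nothing, so \<open>bil v w\<close> is the polar value of \<open>w2\<close> and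
      \<open>w\<close>.\<close>
    have z: "crd (Tr (h w2 w)) 0 = 0" if "w \<in> W" for w
      using v[OF that] iso[OF w(1) that] bil_act_\<alpha>[OF F[OF w(2) that]] by (simp add: w(3) bil_add)
    have "bil u w2 = 0" for u
    proof -
      obtain u1 u2 where u: "u1 \<in> W" "u2 \<in> W" "u = u1 + sm u2 \<alpha>" using decomp by blast
      have "crd (Tr (h u2 w2)) 0 = 0" using z[OF u(2)] Tr_h_sym[of w2 u2] by simp
      then show ?thesis
        using iso[OF u(1) w(2)] bil_act_\<alpha>[OF F[OF u(2) w(2)]] by (simp add: u(3) bil_add)
    qed
    then have "w2 = 0" by (rule bil_nondegenerate[OF m])
    then show ?thesis using w EV.act_zero_left by simp
  qed
qed

lemma herm_descent_if_quad_descent: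
  assumes "quad_descent sm F K UNIV m (q_form K h B m)"
  shows "herm_descent F K D \<theta> lam UNIV sm h"
proof -
  obtain W where W: "subspace_over sm F W" "scalar_ext_iso sm F K W UNIV"
    and qm: "quad_map sm F W m (q_form K h B m)"
    using assms unfolding quad_descent_def by blast
  have q: "q_form K h B m w i \<in> F" if "w \<in> W" "i < m" for w i
    using qm that unfolding quad_map_def by simp
  obtain P where P: "unimodular P" and max: "\<And>Q. unimodular Q \<Longrightarrow> P \<subseteq> Q \<Longrightarrow> Q = P"
    using maximal_unimodular_exists by blast
  have sP: "subspace_over sm D P" and hP: "\<And>p p'. p \<in> P \<Longrightarrow> p' \<in> P \<Longrightarrow> h p p' \<in> D"
    using P unfolding unimodular_def by auto
  have sPF: "subspace_over sm F P" by (rule D_subspace_F[OF sP])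
  \<comment> \<open>The orthogonal space of \<open>P\<close> is zero; the splitting of the space
    then makes \<open>K_hull P\<close> everything.\<close>
  have orth: "v = 0" if v: "\<And>p. p \<in> P \<Longrightarrow> h p v = 0" for v
  proof (cases "m = 0")
    case True
    \<comment> \<open>An empty basis makes \<open>h v v\<close> an empty sum.\<close>
    then have "h v v = 0" using crd_sum[OF h_self_Symd[of v]] by simp
    then show ?thesis using maximal_unimodular_anisotropic[OF P max v] D_0 by simp
  next
    case False
    then have m: "0 < m" by simp
    \<comment> \<open>Here all components of the system enter, whereas \<open>bil\<close> sees only
      the first.\<close>
    have WD: "h w w \<in> D" if "w \<in> W" for w
    proof -
      have "crd (h w w) j * B j \<in> D" if "j < m" for j
        using q[OF \<open>w \<in> W\<close> that] FD B_D[OF that] D_mult unfolding q_form_crd by blast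
      then have "(\<Sum>j<m. crd (h w w) j * B j) \<in> D" by (intro FE.sub_sum[OF D_subspace]) auto
      then show ?thesis using crd_sum[OF h_self_Symd[of w]] by simp
    qed
    \<comment> \<open>The projection of \<open>w\<close> to \<open>K_hull P\<close> has no
      \<alpha>-part because all \<open>h p w\<close> are in \<open>D\<close>. The remainder is
      orthogonal to \<open>P\<close> with value in \<open>D\<close>, hence zero by
      maximality.\<close>
    have WP: "w \<in> P" if w: "w \<in> W" and o: "\<And>p. p \<in> P \<Longrightarrow> bil p w = 0" for w
    proof -
      have D: "h p w \<in> D" if "p \<in> P" for p using bil_orth_D[OF m sP o that] .
      obtain x where x: "x \<in> K_hull P" "\<And>p. p \<in> P \<Longrightarrow> h p (w - x) = 0"
        using P unfolding unimodular_def by blast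
      obtain p p' where pp: "p \<in> P" "p' \<in> P" "x = p + sm p' \<alpha>" using x unfolding K_hull_def by auto
      have "h p1 (sm p' \<alpha>) \<in> D" if p1: "p1 \<in> P" for p1
      proof -
        have "h p1 (sm p' \<alpha>) = h p1 w - h p1 p" using x(2)[OF p1] by (simp add: pp(3) h_diff h_add)
        then show ?thesis using D[OF p1] hP[OF p1 pp(1)] D_diff by simp
      qed
      then have "p' = 0" by (rule D_valued_\<alpha>_eq_0[OF P pp(2)])
      then have xp: "x = p" using pp EV.act_zero_left by simp
      have "h (w - p) p = 0" "h p (w - p) = 0" using x(2)[OF pp(1)] h_0_sym unfolding xp by auto
      then have "h (w - p) (w - p) = h w w - h p w"
        using h_diff(2)[of "w - p" w p] h_diff(1)[of w p w] by simp
      then have "h (w - p) (w - p) \<in> D" using WD[OF w] D[OF pp(1)] D_diff by simp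
      then have "w - p = 0"
        using maximal_unimodular_anisotropic[OF P max] x(2) unfolding xp by blast
      then show ?thesis using pp by simp
    qed
    have "q_form K h B m w 0 \<in> F" if "w \<in> W" for w by (rule q[OF that m])
    note Wb = bil_quad_descent[OF m W(2,1) this]
    define Po where "Po = {v. \<forall>p\<in>P. bil p v = 0}"
    have sPo: "subspace_over sm F Po"
      unfolding subspace_over_def Po_def using bil_0 bil_add bil_act by simp
    let ?WP = "{w + p | w p. w \<in> W \<and> p \<in> P}"
    have W0: "0 \<in> W" and P0: "0 \<in> P" using FV.sub_0[OF W(1)] FV.sub_0[OF sPF] by auto
    have "v \<in> ?WP"
    \<comment> \<open>A vector orthogonal to \<open>W\<close> and \<open>P\<close> lies in
      \<open>W\<close>, then in \<open>P\<close> by \<open>WP\<close>, where \<open>v\<close> is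
      orthogonal to it.\<close>
    proof (rule bil_double_orthogonal[OF m FV.subspace_plus[OF W(1) sPF]])
      fix x assume x: "\<And>a. a \<in> ?WP \<Longrightarrow> bil x a = 0"
      have "bil x w = 0" if "w \<in> W" for w
        using x[of w] that P0 by (metis (mono_tags, lifting) add.right_neutral mem_Collect_eq)
      then have "x \<in> W" using Wb(2) by blast
      moreover have "bil p x = 0" if "p \<in> P" for p
        using x[of p] that W0 bil_sym[of x p] by (metis (mono_tags, lifting) add_0 mem_Collect_eq)
      ultimately have "x \<in> P" by (rule WP)
      then show "bil x v = 0" using v bil_D_eq_0 D_0 by simp
    qed
    then obtain w p where wp: "w \<in> W" "p \<in> P" "v = w + p" by auto
    \<comment> \<open>Both \<open>v\<close> and \<open>p\<close> are orthogonal to \<open>P\<close>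
      for \<open>bil\<close>, so \<open>w = v - p\<close> is too, and \<open>WP\<close> applies
      again.\<close>
    have "bil p' w = 0" if "p' \<in> P" for p'
    proof -
      have "bil p' v = 0" "bil p' p = 0" using that wp(2) v hP bil_D_eq_0 D_0 by simp_all
      then show ?thesis by (simp add: wp(3) bil_add)
    qed
    then have "w \<in> P" by (rule WP[OF wp(1)])
    then have "v \<in> P" using wp DV.sub_add[OF sP] by simp
    then show ?thesis using P v unfolding unimodular_def by blast
  qed
  have "K_hull P = UNIV"
  proof -
    have "v \<in> K_hull P" for v
    proof -
      obtain x where "x \<in> K_hull P" "\<forall>p\<in>P. h p (v - x) = 0" using P unfolding unimodular_def by blast
      then show ?thesis using orth[of "v - x"] by simp
    qed
    then show ?thesis by auto
  qed
  then show ?thesis by (rule herm_descent_if_unimodular[OF P])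
qed

end

theorem theorem4p2:
  fixes F K D :: "'e::division_ring set"
    and \<theta> \<sigma> :: "'e \<Rightarrow> 'e" and lam :: 'e
    and sm :: "'v::ab_group_add \<Rightarrow> 'e \<Rightarrow> 'v" and h :: "'v \<Rightarrow> 'v \<Rightarrow> 'e"
  assumes F_field: "is_subfield F"
    and K_field: "is_subfield K" and FK: "F \<subseteq> K" and K_central: "K \<subseteq> centre"
    and K_quad: "quadratic_ext F K" and K_sep: "separable_ext F K"
    and D_div: "is_division_subring D" and FD: "F \<subseteq> D"
    and D_fin: "\<exists>X. finite X \<and> X \<subseteq> D \<and> lin_span (*) F X = D"
    and DK: "scalar_ext_iso (*) F K D UNIV"
    and inv: "involution_first_kind D \<theta>"
    and sig: "is_theta_K D K \<theta> \<sigma>"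
    and lam: "lam = 1 \<or> lam = -1"
    and nondeg: "D \<noteq> F \<or> lam \<noteq> -1"
    and herm: "herm_space UNIV \<sigma> lam UNIV sm h"
    and reg: "herm_regular UNIV h"
    and even: "herm_even UNIV \<sigma> lam UNIV h"
  shows "herm_descent F K D \<theta> lam UNIV sm h \<longleftrightarrow>
         (\<exists>B m. is_basis_list F (Symd lam D \<theta>) B m \<and>
                quad_descent sm F K UNIV m (q_form K h B m))"
proof -
  obtain \<alpha> where \<alpha>: "\<alpha> \<in> K" "\<alpha> \<notin> F" "lin_span (*) F {1, \<alpha>} = K"
    using K_quad unfolding quadratic_ext_def by blast
  interpret quadratic_herm F K D \<theta> \<sigma> lam sm h \<alpha>
    by unfold_locales (fact assms \<alpha>)+
  show ?thesis
  proof
    assume hd: "herm_descent F K D \<theta> lam UNIV sm h"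
    \<comment> \<open>Descent of \<open>h\<close> gives descent of the system for every basis, so it
      remains to have one: \<open>Symd\<close> is a subspace of the finite-dimensional
      \<open>D\<close>.\<close>
    obtain X where X: "finite X" "lin_span (*) F X = D" using D_fin by blast
    obtain Y where Y: "finite Y" "lin_span (*) F Y = Symd lam D \<theta>"
      using FE.subspace_finitely_spanned[OF X(1) Symd_D_subspace] Symd_D_subset X(2) by auto
    obtain B m where B: "is_basis_list F (Symd lam D \<theta>) B m"
      using FE.basis_exists[OF Y] unfolding is_basis_list_def by blast
    interpret quadratic_herm_basis F K D \<theta> \<sigma> lam sm h \<alpha> B m
      by unfold_locales (rule B)
    show "\<exists>B m. is_basis_list F (Symd lam D \<theta>) B m \<and> quad_descent sm F K UNIV m (q_form K h B m)"
      using B quad_descent_if_herm_descent[OF hd] by blast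
  next
    assume "\<exists>B m. is_basis_list F (Symd lam D \<theta>) B m \<and> quad_descent sm F K UNIV m (q_form K h B m)"
    then obtain B m where B: "is_basis_list F (Symd lam D \<theta>) B m"
      and qd: "quad_descent sm F K UNIV m (q_form K h B m)" by blast
    interpret quadratic_herm_basis F K D \<theta> \<sigma> lam sm h \<alpha> B m
      by unfold_locales (rule B)
    show "herm_descent F K D \<theta> lam UNIV sm h" by (rule herm_descent_if_quad_descent[OF qd])
  qed
qed

end
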